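(* The density of every sphere packing in $\mathbb{R}^8$ is at most $1.000001$ times the density of the lattice packing given by the $E_8$ root lattice, and the density of every sphere packing in $\mathbb{R}^{24}$ is at most $1.0007071$ times the density of the lattice packing given by the Leech lattice.
   Context: A sphere packing in $\mathbb{R}^n$ is a collection $\mathcal P$ of congruent closed balls (of positive radius) that do not intersect except along their boundaries. Its density is the fraction of space covered by the balls, taken in general to be the upper density $$\Delta=\limsup_{r\to\infty}\ \sup_{p\in\mathbb{R}^n}\frac{\operatorname{vol}(B(p,r)\cap\mathcal P)}{\operatorname{vol}B(p,r)},$$ where $B(p,r)$ is the ball of radius $r$ centered at $p$ and $B(p,r)\cap\mathcal P$ denotes the part of $B(p,r)$ covered by the balls of $\mathcal P$. A lattice $\Lambda\subset\mathbb{R}^n$ is the set of integer linear combinations of a basis of $\mathbb{R}^n$. The lattice packing given by $\Lambda$ consists of balls centered at the points of $\Lambda$ with radius half the length of the shortest nonzero vectors of $\Lambda$. The covolume of $\Lambda$ is $\operatorname{vol}(\mathbb{R}^n/\Lambda)$. An even unimodular lattice is a lattice of covolume $1$ in which $\langle v,v\rangle$ is an even integer for every vector $v$. The $E_8$ root lattice consists of all points of $\mathbb{R}^8$ whose coordinates are either all integers or all halves of odd integers, and sum to an even integer. The Leech lattice is the unique (up to isometry) even unimodular lattice in $\mathbb{R}^{24}$ with no vectors of length $\sqrt2$; its shortest nonzero vectors have length $2$. *)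

theory Defs
  imports "HOL-Analysis.Analysis"
begin

definition sphere_packing :: "'a::euclidean_space set set \<Rightarrow> bool" where
  "sphere_packing P \<longleftrightarrow>
     (\<exists>r>0. \<forall>B\<in>P. \<exists>c. B = cball c r) \<and>
     (\<forall>B\<in>P. \<forall>B'\<in>P. B \<noteq> B' \<longrightarrow> B \<inter> B' \<subseteq> frontier B \<inter> frontier B')"

text \<open>The values are taken in the extended nonnegative reals so that the limes superior and the
  supremum are those of a complete lattice; for a packing all of them are at most 1.  A packing is
  countable, so its union is a Borel set.\<close>

definition packing_density :: "'a::euclidean_space set set \<Rightarrow> ennreal" where
  "packing_density P =
     Limsup at_top (\<lambda>r::real. SUP p. emeasure lborel (cball p r \<inter> \<Union>P) / emeasure lborel (cball p r))"

definition lattice_basis :: "'a::euclidean_space set \<Rightarrow> 'a set \<Rightarrow> bool" where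
  "lattice_basis \<Lambda> B \<longleftrightarrow>
     independent B \<and> span B = UNIV \<and>
     \<Lambda> = {v. \<exists>k::'a \<Rightarrow> int. v = (\<Sum>b\<in>B. of_int (k b) *\<^sub>R b)}"

definition is_lattice :: "'a::euclidean_space set \<Rightarrow> bool" where
  "is_lattice \<Lambda> \<longleftrightarrow> (\<exists>B. lattice_basis \<Lambda> B)"

text \<open>For a lattice the infimum is attained, since a lattice is discrete.\<close>

definition min_length :: "'a::euclidean_space set \<Rightarrow> real" where
  "min_length \<Lambda> = Inf (norm ` (\<Lambda> - {0}))"

definition lattice_packing :: "'a::euclidean_space set \<Rightarrow> 'a set set" where
  "lattice_packing \<Lambda> = (\<lambda>v. cball v (min_length \<Lambda> / 2)) ` \<Lambda>"

definition fundamental_parallelepiped :: "'a::euclidean_space set \<Rightarrow> 'a set" where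
  "fundamental_parallelepiped B =
     {v. \<exists>t::'a \<Rightarrow> real. (\<forall>b\<in>B. 0 \<le> t b \<and> t b < 1) \<and> v = (\<Sum>b\<in>B. t b *\<^sub>R b)}"

text \<open>The volume of the quotient of the space by the lattice is that of a fundamental
  parallelepiped; by \<open>covolume_eq\<close> below it does not depend on the basis.\<close>

definition covolume :: "'a::euclidean_space set \<Rightarrow> real" where
  "covolume \<Lambda> = measure lborel (fundamental_parallelepiped (SOME B. lattice_basis \<Lambda> B))"

lemma fundamental_parallelepiped_borel:
  assumes "independent B" "span B = (UNIV :: 'a::euclidean_space set)"
  shows "fundamental_parallelepiped B \<in> sets borel"
proof -
  have fin: "finite B" using assms(1) by (rule independent_imp_finite)
  have "fundamental_parallelepiped B = {x. \<forall>b\<in>B. representation B x b \<in> {0..<1}}"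
  proof (intro set_eqI iffI)
    fix x assume "x \<in> fundamental_parallelepiped B"
    then obtain t :: "'a \<Rightarrow> real"
      where t: "\<forall>b\<in>B. 0 \<le> t b \<and> t b < 1" "x = (\<Sum>b\<in>B. t b *\<^sub>R b)"
      unfolding fundamental_parallelepiped_def by blast
    have "representation B x b = t b" if "b \<in> B" for b
    proof -
      have "representation B x b = (\<Sum>c\<in>B. representation B (t c *\<^sub>R c) b)"
        unfolding t(2) using assms by (subst representation_sum) auto
      also have "\<dots> = (\<Sum>c\<in>B. t c * (if c = b then 1 else 0))"
        using assms by (intro sum.cong) (auto simp: representation_scale representation_basis)
      also have "\<dots> = t b" using fin that by (simp add: mult_delta_right sum.delta)
      finally show ?thesis .
    qed
    then show "x \<in> {x. \<forall>b\<in>B. representation B x b \<in> {0..<1}}" using t(1) by auto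
  next
    fix x assume "x \<in> {x. \<forall>b\<in>B. representation B x b \<in> {0..<1}}"
    moreover have "(\<Sum>b\<in>B. representation B x b *\<^sub>R b) = x"
      using assms fin by (intro sum_representation_eq) auto
    ultimately show "x \<in> fundamental_parallelepiped B"
      unfolding fundamental_parallelepiped_def by (auto intro!: exI[of _ "representation B x"])
  qed
  moreover have "(\<lambda>x. representation B x b) \<in> borel_measurable borel" for b
  proof -
    have "linear (\<lambda>x. representation B x b)"
      by (rule linearI) (use assms in \<open>auto simp: representation_add representation_scale\<close>)
    then show ?thesis
      by (intro borel_measurable_continuous_onI linear_continuous_on) (simp add: linear_linear)
  qed
  moreover have "{x. \<forall>b\<in>B. representation B x b \<in> {0..<1}}
      = (\<Inter>b\<in>B. (\<lambda>x. representation B x b) -` {0..<1}) \<inter> UNIV" by auto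
  ultimately show ?thesis
    using fin
    by (cases "B = {}") (auto intro!: sets.finite_INT measurable_sets_borel[of _ borel])
qed

lemma fundamental_parallelepiped_domain:
  assumes "lattice_basis \<Lambda> B"
  shows "\<exists>!v. v \<in> \<Lambda> \<and> x - v \<in> fundamental_parallelepiped B"
proof -
  have ind: "independent B" and span: "span B = UNIV"
    and L: "\<Lambda> = {v. \<exists>k::'a \<Rightarrow> int. v = (\<Sum>b\<in>B. of_int (k b) *\<^sub>R b)}"
    using assms unfolding lattice_basis_def by auto
  have fin: "finite B" using ind by (rule independent_imp_finite)
  have uniq: "\<forall>b\<in>B. f b = g b" if "(\<Sum>b\<in>B. f b *\<^sub>R b) = (\<Sum>b\<in>B. g b *\<^sub>R b)"
    for f g :: "'a \<Rightarrow> real"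
  proof -
    have "(\<Sum>b\<in>B. (f b - g b) *\<^sub>R b) = 0" using that by (simp add: scaleR_diff_left sum_subtractf)
    then have "\<forall>b\<in>B. f b - g b = 0" using independentD[OF ind fin subset_refl, of "\<lambda>b. f b - g b"] by blast
    then show ?thesis by simp
  qed
  let ?r = "representation B x"
  have x: "(\<Sum>b\<in>B. ?r b *\<^sub>R b) = x" using ind span fin by (intro sum_representation_eq) auto
  show ?thesis
  proof (rule ex1I)
    let ?v = "\<Sum>b\<in>B. of_int \<lfloor>?r b\<rfloor> *\<^sub>R b"
    have "x - ?v = (\<Sum>b\<in>B. frac (?r b) *\<^sub>R b)"
      by (subst x[symmetric]) (simp add: frac_def scaleR_diff_left sum_subtractf)
    moreover have "?v \<in> \<Lambda>" unfolding L by (auto intro!: exI[of _ "\<lambda>b. \<lfloor>?r b\<rfloor>"])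
    ultimately show "?v \<in> \<Lambda> \<and> x - ?v \<in> fundamental_parallelepiped B"
      unfolding fundamental_parallelepiped_def
      by (auto simp: frac_lt_1 intro!: exI[of _ "\<lambda>b. frac (?r b)"])
  next
    fix w assume w: "w \<in> \<Lambda> \<and> x - w \<in> fundamental_parallelepiped B"
    then obtain k :: "'a \<Rightarrow> int" where k: "w = (\<Sum>b\<in>B. of_int (k b) *\<^sub>R b)" unfolding L by blast
    obtain t :: "'a \<Rightarrow> real"
      where t: "\<forall>b\<in>B. 0 \<le> t b \<and> t b < 1" "x - w = (\<Sum>b\<in>B. t b *\<^sub>R b)"
      using w unfolding fundamental_parallelepiped_def by blast
    have "x = w + (x - w)" by simp
    also have "\<dots> = (\<Sum>b\<in>B. (of_int (k b) + t b) *\<^sub>R b)"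
      unfolding t(2) unfolding k by (simp add: scaleR_add_left sum.distrib)
    finally have "\<forall>b\<in>B. ?r b = of_int (k b) + t b" using x by (intro uniq) simp
    then have "\<lfloor>?r b\<rfloor> = k b" if "b \<in> B" for b using t(1) that by (auto simp: floor_eq_iff)
    then show "w = (\<Sum>b\<in>B. of_int \<lfloor>?r b\<rfloor> *\<^sub>R b)" unfolding k by simp
  qed
qed

lemma lattice_countable:
  assumes "lattice_basis \<Lambda> B"
  shows "countable \<Lambda>"
proof -
  have fin: "finite B" using assms unfolding lattice_basis_def by (auto intro: independent_imp_finite)
  have "\<Lambda> \<subseteq> (\<lambda>k. \<Sum>b\<in>B. of_int (k b) *\<^sub>R b) ` (Pi\<^sub>E B (\<lambda>_. UNIV :: int set))"
  proof
    fix v assume "v \<in> \<Lambda>"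
    then obtain k :: "'a \<Rightarrow> int" where "v = (\<Sum>b\<in>B. of_int (k b) *\<^sub>R b)"
      using assms unfolding lattice_basis_def by blast
    then show "v \<in> (\<lambda>k. \<Sum>b\<in>B. of_int (k b) *\<^sub>R b) ` (Pi\<^sub>E B (\<lambda>_. UNIV :: int set))"
      by (intro image_eqI[of _ _ "restrict k B"]) auto
  qed
  then show ?thesis
    using fin by (meson countable_PiE countable_image countable_subset uncountable_def countableI_type)
qed

lemma lborel_shift: "A \<in> sets borel \<Longrightarrow> emeasure lborel ((+) v ` A) = emeasure lborel (A :: 'a::euclidean_space set)"
proof -
  assume A: "A \<in> sets borel"
  have im: "(+) v ` A = (+) (-v) -` A"
  proof (intro set_eqI iffI)
    fix x assume "x \<in> (+) (-v) -` A"
    then show "x \<in> (+) v ` A" by (intro image_eqI[of _ _ "-v + x"]) auto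
  qed auto
  have "emeasure lborel A = emeasure (distr lborel borel ((+) (-v))) A"
    by (simp add: lborel_distr_plus)
  also have "\<dots> = emeasure lborel ((+) (-v) -` A)" using A by (subst emeasure_distr) auto
  finally show ?thesis unfolding im by simp
qed

lemma fundamental_domain_le:
  fixes F G :: "'a::euclidean_space set"
  assumes C: "countable \<Lambda>" and F: "F \<in> sets borel" and G: "G \<in> sets borel"
    and neg: "\<And>v. v \<in> \<Lambda> \<Longrightarrow> - v \<in> \<Lambda>"
    and dF: "\<And>x. \<exists>!v. v \<in> \<Lambda> \<and> x - v \<in> F" and dG: "\<And>x. \<exists>!v. v \<in> \<Lambda> \<and> x - v \<in> G"
  shows "emeasure lborel F \<le> emeasure lborel G"
proof -
  let ?A = "\<lambda>v. (+) v -` F \<inter> G"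
  have m: "?A v \<in> sets borel" for v
    using F G by (intro sets.Int measurable_sets_borel[of _ borel]) auto
  have im: "(+) v ` ?A v = {x \<in> F. x - v \<in> G}" for v
  proof (intro set_eqI iffI)
    fix x assume "x \<in> {x \<in> F. x - v \<in> G}"
    then show "x \<in> (+) v ` ?A v" by (intro image_eqI[of _ _ "x - v"]) auto
  qed auto
  have m2: "(+) v ` ?A v \<in> sets borel" for v
  proof -
    have "(+) v ` ?A v = F \<inter> (\<lambda>x. x - v) -` G" unfolding im by auto
    then show ?thesis using F G by (auto intro!: measurable_sets_borel[of _ borel])
  qed
  have "emeasure lborel F = emeasure lborel (\<Union>v\<in>\<Lambda>. (+) v ` ?A v)"
    unfolding im using dG by (intro arg_cong[where f = "emeasure lborel"]) blast
  also have "\<dots> = (\<integral>\<^sup>+v. emeasure lborel ((+) v ` ?A v) \<partial>count_space \<Lambda>)"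
    by (rule emeasure_UN_countable)
       (use m2 C dG in \<open>auto simp: disjoint_family_on_def im\<close>)
  also have "\<dots> = (\<integral>\<^sup>+v. emeasure lborel (?A v) \<partial>count_space \<Lambda>)"
    using m by (simp add: lborel_shift)
  also have "\<dots> = emeasure lborel (\<Union>v\<in>\<Lambda>. ?A v)"
  proof (rule emeasure_UN_countable[symmetric])
    show "disjoint_family_on ?A \<Lambda>"
    proof (clarsimp simp: disjoint_family_on_def, rule equals0I)
      fix v w x assume "v \<in> \<Lambda>" "w \<in> \<Lambda>" "v \<noteq> w"
        and "x \<in> (+) v -` F \<inter> G \<inter> ((+) w -` F \<inter> G)"
      then have "v + x \<in> F" "w + x \<in> F" by auto
      then have "x - (- v) \<in> F" "x - (- w) \<in> F" by (simp_all add: add.commute)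
      then have "- v = - w" using dF[of x] neg \<open>v \<in> \<Lambda>\<close> \<open>w \<in> \<Lambda>\<close> by blast
      then show False using \<open>v \<noteq> w\<close> by simp
    qed
  qed (use m C in auto)
  also have "\<dots> \<le> emeasure lborel G" using G by (intro emeasure_mono) auto
  finally show ?thesis .
qed

lemma covolume_eq:
  assumes "lattice_basis \<Lambda> B"
  shows "covolume \<Lambda> = measure lborel (fundamental_parallelepiped B)"
proof -
  define B' where "B' = (SOME B. lattice_basis \<Lambda> B)"
  have B': "lattice_basis \<Lambda> B'" unfolding B'_def using assms by (rule someI)
  have neg: "- v \<in> \<Lambda>" if v: "v \<in> \<Lambda>" for v
  proof -
    obtain k :: "'a \<Rightarrow> int" where "v = (\<Sum>b\<in>B. of_int (k b) *\<^sub>R b)"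
      using assms v unfolding lattice_basis_def by blast
    then have "- v = (\<Sum>b\<in>B. of_int (- k b) *\<^sub>R b)" by (simp add: sum_negf)
    then show ?thesis using assms unfolding lattice_basis_def by (auto intro!: exI[of _ "\<lambda>b. - k b"])
  qed
  have "emeasure lborel (fundamental_parallelepiped B') = emeasure lborel (fundamental_parallelepiped B)"
    using assms B' neg unfolding lattice_basis_def[of \<Lambda>]
    by (intro antisym fundamental_domain_le[of \<Lambda>] lattice_countable[OF assms] neg
        fundamental_parallelepiped_domain[OF assms] fundamental_parallelepiped_domain[OF B']
        fundamental_parallelepiped_borel) auto
  then show ?thesis unfolding covolume_def B'_def[symmetric] measure_def by simp
qed

definition even_unimodular :: "'a::euclidean_space set \<Rightarrow> bool" where
  "even_unimodular \<Lambda> \<longleftrightarrow>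
     is_lattice \<Lambda> \<and> covolume \<Lambda> = 1 \<and> (\<forall>v\<in>\<Lambda>. \<exists>m::int. even m \<and> v \<bullet> v = of_int m)"

definition E8_lattice :: "(real ^ 8) set" where
  "E8_lattice =
     {x. ((\<forall>i. x $ i \<in> \<int>) \<or> (\<forall>i. \<exists>k::int. odd k \<and> x $ i = of_int k / 2)) \<and>
         (\<exists>m::int. even m \<and> (\<Sum>i\<in>UNIV. x $ i) = of_int m)}"

text \<open>The Leech lattice is determined only up to isometry, so it is given by the predicate that
  characterizes its isometric copies.\<close>

definition Leech_lattice :: "(real ^ 24) set \<Rightarrow> bool" where
  "Leech_lattice \<Lambda> \<longleftrightarrow> even_unimodular \<Lambda> \<and> (\<forall>v\<in>\<Lambda>. norm v \<noteq> sqrt 2)"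

end

theory Submission
  imports Defs "HOL-Probability.Probability"
begin

text \<open>The proof is the linear programming method of Cohn and Elkies.  Let \<open>f\<close> be the Fourier transform of an
integrable function \<open>g \<ge> 0\<close>, so that \<open>f\<close> is positive definite, and let \<open>f x \<le> 0\<close> for \<open>norm x \<ge> r\<close>
and \<open>c = \<integral> f > 0\<close>.  Let \<open>X\<close> be \<open>N\<close> points of a large ball \<open>B\<close> of volume \<open>V\<close> with mutual distances
at least \<open>r\<close>.  Positive definiteness, tested on the signed measure that puts mass 1 on every point of
\<open>X\<close> and subtracts \<open>N / V\<close> times Lebesgue measure on \<open>B\<close>, says up to boundary effects that
\<open>0 \<le> N * f 0 - 2 * (N / V) * N * c + (N / V)^2 * V * c\<close>, since pairs of distinct points contribute
at most 0 to \<open>\<Sum>x\<in>X. \<Sum>y\<in>X. f (x - y)\<close>.  Hence \<open>N / V \<le> f 0 / c\<close>.  The boundary effects are bounded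
uniformly in the position of the ball (\<open>count_bound\<close>), so this controls the upper density
(\<open>packing_density_le\<close>).  Arguing with the signed measure replaces the Poisson summation formula and the
approximation of packings by periodic ones.

The functions are \<open>f x = p (\<pi> |x|^2) * exp (- \<pi> |x|^2)\<close> with \<open>p\<close> a polynomial.  In dimension
\<open>2 * (\<alpha> + 1)\<close>, with respect to the basis \<open>u^k / (\<alpha> + k)!\<close>, the Fourier transform of such a function is
the substitution \<open>X \<mapsto> 1 - X\<close> on coefficient polynomials (\<open>gaussian_poly_fourier\<close>).  A bound therefore
amounts to a polynomial with rational coefficients whose transform is nonnegative on the half line and
which is itself nonpositive beyond some \<open>u0 = \<pi> * r^2\<close>.  Near the optimum both have almost double
roots, at about the (rescaled) squared lengths of the vectors of the lattice; this gives
short certificates for the signs, namely lower bounds by a product of squared linear factors with an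
explicitly nonnegative polynomial (\<open>valid_certificate\<close>).  The arithmetic of checking the certificates is
done by rewriting on lists of integers.

On the other side, the density of a lattice packing is at least the volume of a ball divided by that of
a set whose translates by the lattice cover space (\<open>lattice_packing_density_ge\<close>).  The nonzero
vectors of \<open>E8\<close> have norm at least \<open>sqrt 2\<close>, and those of an even unimodular lattice without vectors of
norm \<open>sqrt 2\<close> have norm at least 2; the covering sets have volume 1.\<close>

section \<open>Fourier transforms of polynomials times Gaussians\<close>

text \<open>This is the characteristic function of the normal distribution, rescaled.\<close>

lemma gaussian_fourier_real:
  fixes s t :: real
  assumes s: "s > 0"
  shows "(CLINT y|lborel. complex_of_real (exp (- (pi * s * y\<^sup>2))) * cis (2 * pi * t * y))
           = complex_of_real (exp (- (pi * t\<^sup>2 / s)) / sqrt s)"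
    and "complex_integrable lborel (\<lambda>y. complex_of_real (exp (- (pi * s * y\<^sup>2))) * cis (2 * pi * t * y))"
proof -
  \<comment> \<open>The dilation by \<open>c\<close> turns the standard normal density into \<open>exp (- (pi * s * y^2))\<close>.\<close>
  define c where "c = sqrt (2 * pi * s)"
  have c: "c > 0" "c\<^sup>2 = 2 * pi * s" using s by (simp_all add: c_def)
  let ?h = "\<lambda>u y. complex_of_real (std_normal_density y) * cis (u * y)"
  define u where "u = 2 * pi * t / c"
  have [measurable]: "cis \<in> borel_measurable borel"
    by (intro borel_measurable_continuous_onI continuous_on_cis continuous_on_id)
  have int: "complex_integrable lborel (?h u)"
    by (rule Bochner_Integration.integrable_bound[OF integrable_normal_moment[of 1 0 0]])
       (auto simp: norm_mult)
  have "char std_normal_distribution u = (CLINT y|lborel. ?h u y)"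
    unfolding char_def by (subst integral_density) (auto simp: cis_conv_exp scaleR_conv_of_real mult_ac)
  then have val: "(CLINT y|lborel. ?h u y) = complex_of_real (exp (- (u\<^sup>2) / 2))"
    by (simp add: char_std_normal_distribution)
  have eq: "?h u (0 + c * y) = complex_of_real (1 / sqrt (2 * pi)) *
      (complex_of_real (exp (- (pi * s * y\<^sup>2))) * cis (2 * pi * t * y))" for y
  proof -
    have 1: "(c * y)\<^sup>2 / 2 = pi * s * y\<^sup>2" by (simp add: power_mult_distrib c(2))
    have 2: "u * (c * y) = 2 * pi * t * y" using c(1) by (simp add: u_def)
    have "?h u (0 + c * y) = complex_of_real (1 / sqrt (2 * pi)) *
      (complex_of_real (exp (- ((c * y)\<^sup>2 / 2))) * cis (u * (c * y)))"
      by (simp add: std_normal_density_def)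
    then show ?thesis unfolding 1 2 .
  qed
  have "complex_integrable lborel (\<lambda>y. complex_of_real (sqrt (2 * pi)) * ?h u (0 + c * y))"
    using int c(1) by (intro integrable_mult_right impI, subst lborel_integrable_real_affine_iff) auto
  then show "complex_integrable lborel (\<lambda>y. complex_of_real (exp (- (pi * s * y\<^sup>2))) * cis (2 * pi * t * y))"
    unfolding eq by simp
  have "(CLINT y|lborel. ?h u y) = c *\<^sub>R (CLINT y|lborel. ?h u (0 + c * y))"
    using c(1) by (subst lborel_integral_real_affine[of c _ 0]) auto
  also have "\<dots> = complex_of_real (c / sqrt (2 * pi)) * (CLINT y|lborel. complex_of_real (exp (- (pi * s * y\<^sup>2))) * cis (2 * pi * t * y))"
    unfolding eq by (subst integral_mult_right_zero) (simp add: scaleR_conv_of_real)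
  also have "c / sqrt (2 * pi) = sqrt s" by (simp add: c_def real_sqrt_mult)
  finally have "complex_of_real (sqrt s) * (CLINT y|lborel. complex_of_real (exp (- (pi * s * y\<^sup>2))) * cis (2 * pi * t * y))
     = complex_of_real (exp (- (u\<^sup>2) / 2))" using val by simp
  moreover have "u\<^sup>2 / 2 = pi * t\<^sup>2 / s"
    unfolding u_def power_divide c(2) using s by (simp add: field_simps power2_eq_square)
  ultimately show "(CLINT y|lborel. complex_of_real (exp (- (pi * s * y\<^sup>2))) * cis (2 * pi * t * y))
           = complex_of_real (exp (- (pi * t\<^sup>2 / s)) / sqrt s)"
    using s by (simp add: field_simps)
qed

lemma lborel_integral_prod_Basis:
  fixes f :: "'a::euclidean_space \<Rightarrow> real \<Rightarrow> complex"
  assumes f: "\<And>b. b \<in> Basis \<Longrightarrow> complex_integrable lborel (f b)"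
  shows "complex_integrable lborel (\<lambda>x. \<Prod>b\<in>Basis. f b (x \<bullet> b))"
    and "(CLINT x|lborel. (\<Prod>b\<in>Basis. f b (x \<bullet> b))) = (\<Prod>b\<in>Basis. (CLINT y|lborel. f b y))"
proof -
  interpret product_sigma_finite "\<lambda>b::'a. lborel :: real measure" ..
  have meas[measurable]: "f b \<in> borel_measurable borel" if "b \<in> Basis" for b
    using f[OF that] by simp
  have m: "(\<lambda>x::'a. \<Prod>b\<in>Basis. f b (x \<bullet> b)) \<in> borel_measurable borel"
    by (intro borel_measurable_prod) measurable
  have T: "(\<lambda>g. \<Sum>b\<in>Basis. g b *\<^sub>R b) \<in> measurable (\<Pi>\<^sub>M b\<in>(Basis::'a set). lborel) (borel :: 'a measure)"
    by measurable
  have eq: "(\<Prod>b\<in>Basis. f b ((\<Sum>c\<in>Basis. g c *\<^sub>R c) \<bullet> b)) = (\<Prod>b\<in>Basis. f b (g b))" for g :: "'a \<Rightarrow> real"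
    by (intro prod.cong refl) (simp add: inner_sum_left inner_Basis if_distrib sum.delta cong: if_cong)
  show "complex_integrable lborel (\<lambda>x. \<Prod>b\<in>Basis. f b (x \<bullet> b))"
    by (subst lborel_eq, subst integrable_distr_eq[OF T m])
       (simp add: eq product_integrable_prod f)
  show "(CLINT x|lborel. (\<Prod>b\<in>Basis. f b (x \<bullet> b))) = (\<Prod>b\<in>Basis. (CLINT y|lborel. f b y))"
    by (subst lborel_eq, subst integral_distr[OF T m])
       (simp add: eq product_integral_prod f)
qed

lemma cis_sum: "finite A \<Longrightarrow> cis (\<Sum>a\<in>A. f a) = (\<Prod>a\<in>A. cis (f a))"
  by (induction A rule: finite_induct) (auto simp: cis_mult[symmetric])

lemma gaussian_fourier:
  fixes x :: "'a::euclidean_space"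
  assumes s: "s > 0"
  shows "integrable lborel (\<lambda>y::'a. exp (- (pi * s * (y \<bullet> y))) * cos (2 * pi * (x \<bullet> y)))"
    and "(LINT y|lborel. exp (- (pi * s * (y \<bullet> y))) * cos (2 * pi * (x \<bullet> y)))
           = exp (- (pi * (x \<bullet> x) / s)) / sqrt s ^ DIM('a)"
proof -
  let ?f = "\<lambda>b y. complex_of_real (exp (- (pi * s * y\<^sup>2))) * cis (2 * pi * (x \<bullet> b) * y)"
  have eq: "(\<Prod>b\<in>Basis. ?f b (y \<bullet> b)) = complex_of_real (exp (- (pi * s * (y \<bullet> y)))) * cis (2 * pi * (x \<bullet> y))" for y
  proof -
    have 1: "(\<Prod>b\<in>Basis. complex_of_real (exp (- (pi * s * (y \<bullet> b)\<^sup>2)))) = complex_of_real (exp (- (pi * s * (y \<bullet> y))))"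
      unfolding euclidean_inner[of y y]
      by (simp add: exp_sum[symmetric] of_real_prod[symmetric] sum_negf sum_distrib_left power2_eq_square
               del: of_real_prod)
    have 2: "(\<Prod>b\<in>Basis. cis (2 * pi * (x \<bullet> b) * (y \<bullet> b))) = cis (2 * pi * (x \<bullet> y))"
      unfolding euclidean_inner[of x y] by (simp add: cis_sum[symmetric] sum_distrib_left mult_ac)
    show ?thesis by (simp add: prod.distrib 1 2)
  qed
  have int: "complex_integrable lborel (\<lambda>y. complex_of_real (exp (- (pi * s * (y \<bullet> y)))) * cis (2 * pi * (x \<bullet> y)))"
    using lborel_integral_prod_Basis(1)[of ?f] gaussian_fourier_real(2)[OF s] unfolding eq by blast
  have "(CLINT y|lborel. complex_of_real (exp (- (pi * s * (y \<bullet> y)))) * cis (2 * pi * (x \<bullet> y)))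
      = (\<Prod>b\<in>Basis. complex_of_real (exp (- (pi * (x \<bullet> b)\<^sup>2 / s)) / sqrt s))"
    using lborel_integral_prod_Basis(2)[of ?f, OF gaussian_fourier_real(2)[OF s]] unfolding eq gaussian_fourier_real(1)[OF s] .
  also have "\<dots> = complex_of_real (exp (- (pi * (x \<bullet> x) / s)) / sqrt s ^ DIM('a))"
    unfolding euclidean_inner[of x x]
    by (simp add: exp_sum[symmetric] of_real_prod[symmetric] prod_dividef sum_negf sum_distrib_left sum_divide_distrib power2_eq_square
               del: of_real_prod of_real_divide)
  finally have val: "(CLINT y|lborel. complex_of_real (exp (- (pi * s * (y \<bullet> y)))) * cis (2 * pi * (x \<bullet> y)))
     = complex_of_real (exp (- (pi * (x \<bullet> x) / s)) / sqrt s ^ DIM('a))" .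
  show "integrable lborel (\<lambda>y::'a. exp (- (pi * s * (y \<bullet> y))) * cos (2 * pi * (x \<bullet> y)))"
    using integrable_Re[OF int] by simp
  show "(LINT y|lborel. exp (- (pi * s * (y \<bullet> y))) * cos (2 * pi * (x \<bullet> y)))
           = exp (- (pi * (x \<bullet> x) / s)) / sqrt s ^ DIM('a)"
    using integral_Re[OF int] unfolding val by simp
qed

lemma power_le_fact_exp:
  fixes x :: real
  assumes "x \<ge> 0"
  shows "x ^ k \<le> fact k * exp x"
proof -
  have "(\<Sum>n\<in>{k}. x ^ n /\<^sub>R fact n) \<le> (\<Sum>n. x ^ n /\<^sub>R fact n)"
    using assms by (intro sum_le_suminf summable_exp_generic) auto
  then show ?thesis by (simp add: exp_def divide_simps mult.commute)
qed

lemma exp_second_order_bound: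
  fixes t :: real
  shows "\<bar>exp t - 1 - t\<bar> \<le> t\<^sup>2 * exp \<bar>t\<bar>"
proof -
  have a: "1 - exp t \<le> - t" using exp_ge_add_one_self[of t] by linarith
  have "exp t * (1 - t) \<le> exp t * exp (- t)" using exp_ge_add_one_self[of "- t"] by (intro mult_left_mono) auto
  then have b: "exp t - 1 \<le> t * exp t" by (simp add: exp_minus algebra_simps)
  have "t * (exp t - 1) \<le> t\<^sup>2 * exp \<bar>t\<bar>"
  proof (cases "t \<ge> 0")
    case True
    then show ?thesis using mult_left_mono[OF b, of t] by (simp add: power2_eq_square mult_ac)
  next
    case False
    have "t * (exp t - 1) = (- t) * (1 - exp t)" by (simp add: algebra_simps)
    also have "\<dots> \<le> (- t) * (- t)" using False a by (intro mult_left_mono) auto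
    also have "\<dots> \<le> t\<^sup>2 * exp \<bar>t\<bar>" by (simp add: power2_eq_square mult_le_cancel_left1)
    finally show ?thesis .
  qed
  moreover have "exp t - 1 - t \<le> t * (exp t - 1)" using b by (simp add: algebra_simps)
  ultimately show ?thesis using a by linarith
qed

text \<open>Differentiation under the integral sign below needs only this elementary criterion, because for the
exponential the second order remainder is again dominated by an integrable function.\<close>

lemma DERIV_quadratic_bound:
  fixes f :: "real \<Rightarrow> real"
  assumes d: "d > 0" and b: "\<And>h. \<bar>h\<bar> \<le> d \<Longrightarrow> \<bar>f (x + h) - f x - h * D\<bar> \<le> C * h\<^sup>2"
  shows "DERIV f x :> D"
  unfolding DERIV_def
proof (subst LIM_zero_iff[symmetric], rule Lim_null_comparison)
  show "\<forall>\<^sub>F h in at 0. norm ((f (x + h) - f x) / h - D) \<le> \<bar>C\<bar> * \<bar>h\<bar>"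
    unfolding eventually_at
  proof (intro exI[of _ d] conjI ballI impI d)
    fix h :: real assume h: "h \<noteq> 0 \<and> dist h 0 < d"
    then have "norm ((f (x + h) - f x) / h - D) = \<bar>f (x + h) - f x - h * D\<bar> / \<bar>h\<bar>"
      by (simp add: field_simps flip: abs_divide)
    also have "\<dots> \<le> C * h\<^sup>2 / \<bar>h\<bar>" using b[of h] h by (intro divide_right_mono) auto
    also have "\<dots> = C * \<bar>h\<bar>" using h by (simp add: power2_eq_square abs_if)
    also have "\<dots> \<le> \<bar>C\<bar> * \<bar>h\<bar>" by (intro mult_right_mono) auto
    finally show "norm ((f (x + h) - f x) / h - D) \<le> \<bar>C\<bar> * \<bar>h\<bar>" .
  qed
  show "((\<lambda>h. \<bar>C\<bar> * \<bar>h\<bar>) \<longlongrightarrow> 0) (at (0::real))"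
    by (auto intro!: tendsto_eq_intros)
qed

text \<open>Half of the exponential decay absorbs the power of \<open>w\<close>.\<close>

lemma integrable_power_exp:
  fixes w \<phi> :: "'a \<Rightarrow> real"
  assumes int: "\<And>s. s > 0 \<Longrightarrow> integrable M (\<lambda>y. exp (- (s * w y)))"
    and w: "w \<in> borel_measurable M" "\<And>y. w y \<ge> 0"
    and \<phi>: "\<phi> \<in> borel_measurable M" "\<And>y. \<bar>\<phi> y\<bar> \<le> 1"
    and s: "s > 0"
  shows "integrable M (\<lambda>y. w y ^ k * exp (- (s * w y)) * \<phi> y)"
proof (rule Bochner_Integration.integrable_bound)
  show "integrable M (\<lambda>y. fact k * (2 / s) ^ k * exp (- ((s / 2) * w y)))"
    using int[of "s / 2"] s by simp
  show "(\<lambda>y. w y ^ k * exp (- (s * w y)) * \<phi> y) \<in> borel_measurable M"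
    using w(1) \<phi>(1) by measurable
  have "norm (w y ^ k * exp (- (s * w y)) * \<phi> y) \<le> norm (fact k * (2 / s) ^ k * exp (- ((s / 2) * w y)))" for y
  proof -
    have "w y ^ k = (2 / s) ^ k * ((s / 2) * w y) ^ k" using s by (simp add: power_mult_distrib[symmetric])
    also have "\<dots> \<le> (2 / s) ^ k * (fact k * exp ((s / 2) * w y))"
      using s w(2)[of y] by (intro mult_left_mono power_le_fact_exp) auto
    finally have "w y ^ k * exp (- (s * w y)) \<le> (2 / s) ^ k * (fact k * exp ((s / 2) * w y)) * exp (- (s * w y))"
      by (rule mult_right_mono) simp
    also have "\<dots> = fact k * (2 / s) ^ k * exp (- ((s / 2) * w y))"
      by (simp add: mult_ac flip: exp_add)
    finally have 1: "w y ^ k * exp (- (s * w y)) \<le> fact k * (2 / s) ^ k * exp (- ((s / 2) * w y))" .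
    have "norm (w y ^ k * exp (- (s * w y)) * \<phi> y) \<le> w y ^ k * exp (- (s * w y)) * 1"
      using w(2)[of y] \<phi>(2)[of y] unfolding norm_mult by (intro mult_mono) auto
    with 1 show ?thesis using s by simp
  qed
  then show "AE y in M. norm (w y ^ k * exp (- (s * w y)) * \<phi> y) \<le> norm (fact k * (2 / s) ^ k * exp (- ((s / 2) * w y)))"
    by simp
qed

lemma DERIV_power_exp_integral:
  fixes w \<phi> :: "'a \<Rightarrow> real"
  assumes int: "\<And>s. s > 0 \<Longrightarrow> integrable M (\<lambda>y. exp (- (s * w y)))"
    and w: "w \<in> borel_measurable M" "\<And>y. w y \<ge> 0"
    and \<phi>: "\<phi> \<in> borel_measurable M" "\<And>y. \<bar>\<phi> y\<bar> \<le> 1"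
    and s: "s > 0"
  shows "DERIV (\<lambda>s. LINT y|M. w y ^ k * exp (- (s * w y)) * \<phi> y) s
           :> - (LINT y|M. w y ^ Suc k * exp (- (s * w y)) * \<phi> y)"
proof (rule DERIV_quadratic_bound)
  show "s / 2 > 0" using s by simp
  have I: "integrable M (\<lambda>y. w y ^ k * exp (- (s * w y)) * \<phi> y)" if "s > 0" for s k
    by (rule integrable_power_exp) (use assms that in auto)
  fix h :: real assume h: "\<bar>h\<bar> \<le> s / 2"
  then have sh: "s + h > 0" using s by (auto simp: abs_if split: if_splits)
  let ?F = "\<lambda>s y. w y ^ k * exp (- (s * w y)) * \<phi> y"
  let ?G = "\<lambda>y. w y ^ Suc k * exp (- (s * w y)) * \<phi> y"
  let ?B = "\<lambda>y. w y ^ (k + 2) * exp (- ((s / 2) * w y))"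
  have IB: "integrable M ?B"
    using integrable_power_exp[where w = w and \<phi> = "\<lambda>_. 1" and s = "s / 2" and k = "k + 2", OF int] w s by simp
  have 1: "(LINT y|M. ?F (s + h) y) - (LINT y|M. ?F s y) - h * - (LINT y|M. ?G y)
      = (LINT y|M. ?F (s + h) y - ?F s y + h * ?G y)"
    using I[OF sh, of k] I[OF s, of k] I[OF s, of "Suc k"] by (simp del: power_Suc)
  have 2: "\<bar>LINT y|M. ?F (s + h) y - ?F s y + h * ?G y\<bar> \<le> (LINT y|M. h\<^sup>2 * ?B y)"
  proof (rule integral_abs_bound[THEN order_trans], rule integral_mono)
    show "integrable M (\<lambda>y. \<bar>?F (s + h) y - ?F s y + h * ?G y\<bar>)"
      using I[OF sh, of k] I[OF s, of k] I[OF s, of "Suc k"] by (intro integrable_abs Bochner_Integration.integrable_add Bochner_Integration.integrable_diff integrable_mult_right)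
    show "integrable M (\<lambda>y. h\<^sup>2 * ?B y)" using IB by simp
    fix y
    let ?t = "- (h * w y)"
    have "exp (- ((s + h) * w y)) = exp (- (s * w y)) * exp ?t"
      by (simp add: algebra_simps flip: exp_add)
    then have "?F (s + h) y - ?F s y + h * ?G y = w y ^ k * exp (- (s * w y)) * (exp ?t - 1 - ?t) * \<phi> y"
      by (simp add: algebra_simps)
    then have "\<bar>?F (s + h) y - ?F s y + h * ?G y\<bar> = w y ^ k * exp (- (s * w y)) * \<bar>exp ?t - 1 - ?t\<bar> * \<bar>\<phi> y\<bar>"
      using w(2)[of y] by (simp add: abs_mult)
    also have "\<dots> \<le> w y ^ k * exp (- (s * w y)) * (?t\<^sup>2 * exp \<bar>?t\<bar>) * 1"
      using w(2)[of y] \<phi>(2)[of y] exp_second_order_bound[of ?t] by (intro mult_mono mult_left_mono) auto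
    also have "\<dots> \<le> w y ^ k * exp (- (s * w y)) * (?t\<^sup>2 * exp ((s / 2) * w y)) * 1"
    proof -
      have "\<bar>?t\<bar> = \<bar>h\<bar> * w y" using w(2)[of y] by (simp add: abs_mult)
      also have "\<dots> \<le> (s / 2) * w y" by (rule mult_right_mono[OF h w(2)])
      finally have "\<bar>?t\<bar> \<le> (s / 2) * w y" .
      then show ?thesis using w(2)[of y] by (intro mult_right_mono mult_left_mono) auto
    qed
    also have "\<dots> = h\<^sup>2 * ?B y"
    proof -
      have "exp (- (s * w y)) * exp ((s / 2) * w y) = exp (- ((s / 2) * w y))" by (simp flip: exp_add)
      then show ?thesis by (simp add: power_mult_distrib power_add power2_eq_square mult_ac)
    qed
    finally show "\<bar>?F (s + h) y - ?F s y + h * ?G y\<bar> \<le> h\<^sup>2 * ?B y" .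
  qed
  have 3: "(LINT y|M. h\<^sup>2 * ?B y) = (LINT y|M. ?B y) * h\<^sup>2" by simp
  show "\<bar>(LINT y|M. ?F (s + h) y) - (LINT y|M. ?F s y) - h * - (LINT y|M. ?G y)\<bar>
      \<le> (LINT y|M. ?B y) * h\<^sup>2"
    using 2 unfolding 1 3 .
qed

text \<open>The basis \<open>u^k / (\<alpha> + k)!\<close> is the one in which the Fourier transform of radial Gaussian polynomials in
dimension \<open>2 * (\<alpha> + 1)\<close> is a substitution.  The image of \<open>(1 - X)^k\<close> is, up to the factor
\<open>k! / (\<alpha> + k)!\<close>, the Laguerre polynomial with parameter \<open>\<alpha>\<close>.\<close>

definition borel_transform :: "nat \<Rightarrow> real poly \<Rightarrow> real poly" where
  "borel_transform \<alpha> p = (\<Sum>k\<le>degree p. monom (coeff p k / fact (\<alpha> + k)) k)"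

lemma coeff_borel_transform: "coeff (borel_transform \<alpha> p) k = coeff p k / fact (\<alpha> + k)"
  by (auto simp: borel_transform_def coeff_sum coeff_eq_0)

lemma borel_transform_sum: "borel_transform \<alpha> (\<Sum>k\<in>A. f k) = (\<Sum>k\<in>A. borel_transform \<alpha> (f k))"
  by (rule poly_eqI) (simp add: coeff_borel_transform coeff_sum sum_divide_distrib)

lemma borel_transform_smult: "borel_transform \<alpha> (smult c p) = smult c (borel_transform \<alpha> p)"
  by (rule poly_eqI) (simp add: coeff_borel_transform)

lemma borel_transform_monom: "borel_transform \<alpha> (monom c k) = monom (c / fact (\<alpha> + k)) k"
  by (rule poly_eqI) (simp add: coeff_borel_transform)

text \<open>Multiplication by \<open>u\<close> on the transformed side is \<open>p \<mapsto> (\<alpha> + 1) * X * p + X^2 * p'\<close> before the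
transform, and \<open>u * d/du\<close> is \<open>X * d/dX\<close> on both sides.\<close>

lemma borel_transform_derivation:
  "[:0, 1:] * pderiv (borel_transform \<alpha> p) + smult c (borel_transform \<alpha> p) - [:0, 1:] * borel_transform \<alpha> p
     = borel_transform \<alpha> (smult c p + [:0, 1:] * pderiv p - [:0, 1:] * (smult (real \<alpha> + 1) p + [:0, 1:] * pderiv p))"
proof (rule poly_eqI)
  fix k
  show "coeff ([:0, 1:] * pderiv (borel_transform \<alpha> p) + smult c (borel_transform \<alpha> p) - [:0, 1:] * borel_transform \<alpha> p) k
     = coeff (borel_transform \<alpha> (smult c p + [:0, 1:] * pderiv p - [:0, 1:] * (smult (real \<alpha> + 1) p + [:0, 1:] * pderiv p))) k"
  proof (cases k)
    case 0
    then show ?thesis by (simp add: coeff_borel_transform)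
  next
    case (Suc j)
    have X: "coeff ([:0, 1:] * q) (Suc i) = coeff q i" for q :: "real poly" and i by simp
    have X2: "coeff ([:0, 1:] * pderiv q) i = real i * coeff q i" for q :: "real poly" and i
      by (cases i) (simp_all add: coeff_pderiv)
    define A F :: real where "A = real \<alpha> + 1 + real j" and "F = fact (\<alpha> + j)"
    have A: "A > 0" "F > 0" by (simp_all add: A_def F_def add_pos_nonneg)
    have F': "fact (\<alpha> + Suc j) = A * F" by (simp add: A_def F_def algebra_simps)
    have A': "(real \<alpha> + 1) * coeff p j + real j * coeff p j = A * coeff p j" by (simp add: A_def algebra_simps)
    show ?thesis
      unfolding Suc coeff_borel_transform coeff_add coeff_diff X2 coeff_smult
      unfolding X coeff_add X2 coeff_smult coeff_borel_transform A' F' F_def[symmetric]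
      using A by (simp add: field_simps)
  qed
qed

text \<open>The left-hand side is what differentiation in \<open>s\<close> makes of the closed form in
\<open>gaussian_moment_fourier\<close>, so this identity is its induction step.\<close>

lemma borel_transform_recursion:
  "[:0, 1:] * pderiv (borel_transform \<alpha> ([:1, -1:] ^ k))
      + smult (real (\<alpha> + Suc k)) (borel_transform \<alpha> ([:1, -1:] ^ k)) - [:0, 1:] * borel_transform \<alpha> ([:1, -1:] ^ k)
     = smult (real (\<alpha> + Suc k)) (borel_transform \<alpha> ([:1, -1:] ^ Suc k))"
proof -
  let ?X = "[:0, 1:] :: real poly" and ?r = "[:1, -1:] ^ k :: real poly"
  have d: "(1 - ?X) * pderiv ?r = smult (- real k) ?r"
  proof (cases k)
    case (Suc n)
    have "1 - ?X = [:1, -1:]" "pderiv [:1, -1:] = ([:-1:] :: real poly)" by (simp_all add: one_pCons pderiv_pCons)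
    then show ?thesis
      unfolding Suc pderiv_power_Suc by (intro poly_eqI) (auto simp: coeff_pCons algebra_simps split: nat.split)
  qed simp
  have "smult (real (\<alpha> + Suc k)) ?r + ?X * pderiv ?r - ?X * (smult (real \<alpha> + 1) ?r + ?X * pderiv ?r)
      = smult (real (\<alpha> + Suc k)) ?r - smult (real \<alpha> + 1) (?X * ?r) + ?X * ((1 - ?X) * pderiv ?r)"
    by (simp add: algebra_simps)
  also have "\<dots> = smult (real (\<alpha> + Suc k)) ((1 - ?X) * ?r)"
  proof -
    have "smult (a + c) r - smult a Y + smult (- c) Y = smult (a + c) (r - Y)" for a c and r Y :: "real poly"
      by (rule poly_eqI) (simp add: algebra_simps)
    from this[of "real \<alpha> + 1" "real k" ?r "?X * ?r"] show ?thesis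
      unfolding d mult_smult_right unfolding left_diff_distrib mult_1_left by (simp only: of_nat_add of_nat_Suc add_ac)
  qed
  also have "1 - ?X = [:1, -1:]" by (simp add: one_pCons)
  finally show ?thesis
    unfolding borel_transform_derivation by (simp add: borel_transform_smult)
qed

text \<open>Induction on \<open>k\<close>: differentiation with respect to \<open>s\<close> takes both sides to the negatives of those for
\<open>k + 1\<close>, the left one under the integral sign, the right one by \<open>borel_transform_recursion\<close>.  The dimension is even,
so that the power of \<open>s\<close> is an integer.\<close>

lemma gaussian_moment_fourier:
  fixes x :: "'a::euclidean_space"
  assumes dim: "DIM('a) = 2 * (\<alpha> + 1)" and s: "s > 0"
  shows "(LINT y|lborel. (pi * (y \<bullet> y)) ^ k * exp (- (s * (pi * (y \<bullet> y)))) * cos (2 * pi * (x \<bullet> y)))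
     = fact (\<alpha> + k) * poly (borel_transform \<alpha> ([:1, -1:] ^ k)) (pi * (x \<bullet> x) / s) * exp (- (pi * (x \<bullet> x) / s)) / s ^ (\<alpha> + Suc k)"
  using s
proof (induction k arbitrary: s)
  case 0
  have "sqrt s ^ DIM('a) = s ^ (\<alpha> + 1)" unfolding dim power_mult using 0 by simp
  moreover have "borel_transform \<alpha> 1 = [:1 / fact \<alpha>:]"
    using borel_transform_monom[of \<alpha> 1 0] by (simp add: monom_0 one_pCons)
  ultimately show ?case
    using gaussian_fourier(2)[OF 0, of x] by (simp add: mult_ac)
next
  case (Suc k)
  let ?v = "pi * (x \<bullet> x)" and ?q = "borel_transform \<alpha> ([:1, -1:] ^ k)"
  let ?\<Phi> = "\<lambda>k s. LINT y|lborel. (pi * (y \<bullet> y)) ^ k * exp (- (s * (pi * (y \<bullet> y)))) * cos (2 * pi * (x \<bullet> y))"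
  let ?\<Psi> = "\<lambda>s. fact (\<alpha> + k) * poly ?q (?v / s) * exp (- (?v / s)) / s ^ (\<alpha> + Suc k)"
  have "integrable lborel (\<lambda>y::'a. exp (- (s * (pi * (y \<bullet> y)))))" if "s > 0" for s
    using gaussian_fourier(1)[OF that, of "0::'a"] by (simp add: mult_ac)
  then have 1: "DERIV (?\<Phi> k) s :> - ?\<Phi> (Suc k) s"
    using Suc.prems by (intro DERIV_power_exp_integral) auto
  have "DERIV ?\<Psi> s :> - (fact (\<alpha> + k) * (?v / s * poly (pderiv ?q) (?v / s) + real (\<alpha> + Suc k) * poly ?q (?v / s)
        - ?v / s * poly ?q (?v / s)) * exp (- (?v / s)) / s ^ (\<alpha> + Suc (Suc k)))"
  proof -
    have e: "c * ((P' * (- (v / s\<^sup>2)) * E + E * (v / s\<^sup>2) * P) * (1 / s ^ Suc j) + - (real (Suc j) / s ^ Suc (Suc j)) * (P * E))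
       = - (c * (v / s * P' + real (Suc j) * P - v / s * P) * E / s ^ Suc (Suc j))" for c P P' E v :: real and j
      using Suc.prems by (simp add: field_simps power2_eq_square)
    have 1: "DERIV (\<lambda>s. 1 / s ^ Suc j) s :> - (real (Suc j) / s ^ Suc (Suc j))" for j
    proof -
      have "DERIV (\<lambda>s. inverse (s ^ Suc j)) s :> - (real (Suc j) * s ^ j * inverse ((s ^ Suc j)\<^sup>2))"
        using DERIV_inverse_fun[OF DERIV_pow[of "Suc j" s]] Suc.prems by (simp add: power2_eq_square)
      also have "real (Suc j) * s ^ j * inverse ((s ^ Suc j)\<^sup>2) = real (Suc j) / s ^ Suc (Suc j)"
        using Suc.prems by (simp add: field_simps power2_eq_square)
      finally show ?thesis by (simp add: inverse_eq_divide)
    qed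
    have 2: "DERIV (\<lambda>s. poly ?q (?v / s)) s :> poly (pderiv ?q) (?v / s) * (- (?v / s\<^sup>2))"
      by (rule DERIV_chain2[OF poly_DERIV])
         (use Suc.prems in \<open>auto intro!: derivative_eq_intros simp: power2_eq_square\<close>)
    have 3: "DERIV (\<lambda>s. exp (- (?v / s))) s :> exp (- (?v / s)) * (?v / s\<^sup>2)"
      by (rule DERIV_chain2[OF DERIV_exp])
         (use Suc.prems in \<open>auto intro!: derivative_eq_intros simp: power2_eq_square\<close>)
    from DERIV_cmult[OF DERIV_mult[OF DERIV_mult[OF 2 3] 1[of "\<alpha> + k"]], of "fact (\<alpha> + k)"]
    show ?thesis unfolding e by (simp only: add_Suc_right times_divide_eq_right mult_1_right mult.assoc)
  qed
  also have "?v / s * poly (pderiv ?q) (?v / s) + real (\<alpha> + Suc k) * poly ?q (?v / s) - ?v / s * poly ?q (?v / s)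
     = real (\<alpha> + Suc k) * poly (borel_transform \<alpha> ([:1, -1:] ^ Suc k)) (?v / s)"
    using arg_cong[OF borel_transform_recursion[of \<alpha> k], of "\<lambda>p. poly p (?v / s)"] by (simp del: power_Suc)
  finally have "DERIV ?\<Psi> s :> - (fact (\<alpha> + k) * (real (\<alpha> + Suc k) * poly (borel_transform \<alpha> ([:1, -1:] ^ Suc k)) (?v / s))
       * exp (- (?v / s)) / s ^ (\<alpha> + Suc (Suc k)))" .
  then have "DERIV (?\<Phi> k) s :> - (fact (\<alpha> + k) * (real (\<alpha> + Suc k) * poly (borel_transform \<alpha> ([:1, -1:] ^ Suc k)) (?v / s))
       * exp (- (?v / s)) / s ^ (\<alpha> + Suc (Suc k)))"
    by (rule has_field_derivative_transform_within_open[where S = "{0<..}"]) (use Suc in auto)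
  from DERIV_unique[OF 1 this] show ?case
    by (simp add: mult_ac del: power_Suc)
qed

definition gaussian_poly :: "nat \<Rightarrow> real poly \<Rightarrow> 'a::euclidean_space \<Rightarrow> real" where
  "gaussian_poly \<alpha> p x = poly (borel_transform \<alpha> p) (pi * (x \<bullet> x)) * exp (- (pi * (x \<bullet> x)))"

lemma gaussian_poly_expand:
  "gaussian_poly \<alpha> p x = (\<Sum>k\<le>degree p. coeff p k / fact (\<alpha> + k) * ((pi * (x \<bullet> x)) ^ k * exp (- (1 * (pi * (x \<bullet> x))))))"
  by (simp add: gaussian_poly_def borel_transform_def poly_sum poly_monom sum_distrib_right sum_distrib_left mult_ac)

lemma integrable_gaussian_poly_cos:
  "integrable lborel (\<lambda>y::'a::euclidean_space. gaussian_poly \<alpha> p y * cos (2 * pi * (x \<bullet> y)))"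
proof -
  have int: "integrable lborel (\<lambda>y::'a. exp (- (s * (pi * (y \<bullet> y)))))" if "s > 0" for s
    using gaussian_fourier(1)[OF that, of "0::'a"] by (simp add: mult_ac)
  have "integrable lborel (\<lambda>y::'a. (pi * (y \<bullet> y)) ^ k * exp (- (1 * (pi * (y \<bullet> y)))) * cos (2 * pi * (x \<bullet> y)))" for k
    by (rule integrable_power_exp) (use int in auto)
  then have "integrable lborel (\<lambda>y::'a. \<Sum>k\<le>degree p. coeff p k / fact (\<alpha> + k) *
      ((pi * (y \<bullet> y)) ^ k * exp (- (1 * (pi * (y \<bullet> y)))) * cos (2 * pi * (x \<bullet> y))))"
    by (intro Bochner_Integration.integrable_sum integrable_mult_right)
  then show ?thesis
    unfolding gaussian_poly_expand sum_distrib_right by (simp only: mult.assoc)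
qed

text \<open>Substituting \<open>1 - X\<close> twice gives back \<open>p\<close>; this is the Fourier inversion formula for these functions.\<close>

theorem gaussian_poly_fourier:
  fixes x :: "'a::euclidean_space"
  assumes dim: "DIM('a) = 2 * (\<alpha> + 1)"
  shows "(LINT y|lborel. gaussian_poly \<alpha> p y * cos (2 * pi * (x \<bullet> y))) = gaussian_poly \<alpha> (pcompose p [:1, -1:]) x"
proof -
  have int: "integrable lborel (\<lambda>y::'a. exp (- (s * (pi * (y \<bullet> y)))))" if "s > 0" for s
    using gaussian_fourier(1)[OF that, of "0::'a"] by (simp add: mult_ac)
  let ?g = "\<lambda>k y. (pi * (y \<bullet> y)) ^ k * exp (- (1 * (pi * (y \<bullet> y)))) * cos (2 * pi * (x \<bullet> y))"
  have I: "integrable lborel (?g k)" for k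
    by (rule integrable_power_exp) (use int in auto)
  have pw: "pcompose ([:0, 1:] ^ k) [:1, -1:] = ([:1, -1:] ^ k :: real poly)" for k
  proof (induction k)
    case (Suc k)
    have "pcompose [:0, 1:] [:1, -1:] = ([:1, -1:] :: real poly)" by (simp add: pcompose_pCons)
    then show ?case by (simp only: power_Suc pcompose_mult Suc.IH)
  qed (simp add: pcompose_1)
  have p: "pcompose p [:1, -1:] = (\<Sum>k\<le>degree p. smult (coeff p k) ([:1, -1:] ^ k))"
    by (subst (1) poly_as_sum_of_monoms[of p, symmetric])
       (simp add: pcompose_sum monom_altdef pcompose_smult pw)
  have "(LINT y|lborel. gaussian_poly \<alpha> p y * cos (2 * pi * (x \<bullet> y)))
      = (LINT y|lborel. (\<Sum>k\<le>degree p. coeff p k / fact (\<alpha> + k) * ?g k y))"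
    unfolding gaussian_poly_expand sum_distrib_right by (simp only: mult.assoc)
  also have "\<dots> = (\<Sum>k\<le>degree p. coeff p k / fact (\<alpha> + k) * (LINT y|lborel. ?g k y))"
    using I by simp
  also have "\<dots> = (\<Sum>k\<le>degree p. coeff p k * poly (borel_transform \<alpha> ([:1, -1:] ^ k)) (pi * (x \<bullet> x)) * exp (- (pi * (x \<bullet> x))))"
    by (subst gaussian_moment_fourier[OF dim]) (simp_all add: mult.assoc)
  also have "\<dots> = gaussian_poly \<alpha> (pcompose p [:1, -1:]) x"
    unfolding p gaussian_poly_def borel_transform_sum borel_transform_smult
    by (simp add: poly_sum sum_distrib_right)
  finally show ?thesis .
qed

section \<open>Counting separated points with a positive definite function\<close>

lemma lborel_integral_reflect:
  fixes h :: "'a::euclidean_space \<Rightarrow> real"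
  assumes [measurable]: "h \<in> borel_measurable borel"
  shows "(LINT y|lborel. h (x - y)) = (LINT y|lborel. h y)"
    and "integrable lborel (\<lambda>y. h (x - y)) \<longleftrightarrow> integrable lborel h"
proof -
  have d: "distr lborel borel (\<lambda>y. x - y) = lborel"
    by (subst (2) lborel_affine[of "-1" x]) (auto simp: density_1 one_ennreal_def[symmetric])
  show "(LINT y|lborel. h (x - y)) = (LINT y|lborel. h y)"
    by (subst (2) d[symmetric], subst integral_distr) auto
  show "integrable lborel (\<lambda>y. h (x - y)) \<longleftrightarrow> integrable lborel h"
    by (subst (2) d[symmetric], subst integrable_distr_eq) auto
qed

lemma integrable_indicator_bounded:
  fixes k :: "'a::euclidean_space \<Rightarrow> real"
  assumes [measurable]: "k \<in> borel_measurable borel" "B \<in> sets borel" and fin: "emeasure lborel B < \<infinity>"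
    and C: "\<And>y. \<bar>k y\<bar> \<le> C"
  shows "integrable lborel (\<lambda>y. indicator B y * k y)" 
    and "\<bar>LINT y|lborel. indicator B y * k y\<bar> \<le> C * measure lborel B"
proof -
  have I: "integrable lborel (\<lambda>y. C * indicator B y :: real)" using fin by simp
  have b: "\<bar>indicator B y * k y\<bar> \<le> C * indicator B y" for y
    using C[of y] by (auto simp: indicator_def)
  show J: "integrable lborel (\<lambda>y. indicator B y * k y)"
    by (rule Bochner_Integration.integrable_bound[OF I]) (use b in \<open>auto intro!: AE_I2 intro: order_trans[OF _ abs_ge_self]\<close>)
  have "(LINT y|lborel. \<bar>indicator B y * k y\<bar>) \<le> (LINT y|lborel. C * indicator B y)"
    using I J b by (intro integral_mono) auto
  then have "\<bar>LINT y|lborel. indicator B y * k y\<bar> \<le> (LINT y|lborel. C * indicator B y)"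
    using integral_abs_bound[of lborel "\<lambda>y. indicator B y * k y"] by linarith
  then show "\<bar>LINT y|lborel. indicator B y * k y\<bar> \<le> C * measure lborel B" using fin by simp
qed

text \<open>Fubini for the weight \<open>g\<close> and a window \<open>B\<close>; the kernels are the characters \<open>cos (2 * pi * ((y - z) \<bullet> \<xi>))\<close>
and their averages over \<open>B\<close>.\<close>

lemma integral_weight_swap:
  fixes g :: "'a::euclidean_space \<Rightarrow> real" and k :: "'a \<Rightarrow> 'a \<Rightarrow> real"
  assumes g: "integrable lborel g" and [measurable]: "B \<in> sets borel" and fin: "emeasure lborel B < \<infinity>"
    and k[measurable]: "(\<lambda>(\<xi>, y). k \<xi> y) \<in> borel_measurable (borel \<Otimes>\<^sub>M borel)" and C: "\<And>\<xi> y. \<bar>k \<xi> y\<bar> \<le> C"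
  shows "(LINT \<xi>|lborel. g \<xi> * (LINT y|lborel. indicator B y * k \<xi> y))
       = (LINT y|lborel. indicator B y * (LINT \<xi>|lborel. g \<xi> * k \<xi> y))"
proof -
  have [measurable]: "g \<in> borel_measurable borel" using g by simp
  have ks: "k \<xi> \<in> borel_measurable borel" for \<xi> using measurable_compose[OF measurable_Pair1' k, of \<xi>] by simp
  have m: "(\<lambda>(\<xi>, y). g \<xi> * (indicator B y * k \<xi> y)) \<in> borel_measurable (lborel \<Otimes>\<^sub>M lborel)"
    using k by measurable
  have "integrable (lborel \<Otimes>\<^sub>M lborel) (\<lambda>(\<xi>, y). g \<xi> * (indicator B y * k \<xi> y))"
  proof (rule lborel_pair.Fubini_integrable[OF m])
    show "AE \<xi> in lborel. integrable lborel (\<lambda>y. case (\<xi>, y) of (\<xi>, y) \<Rightarrow> g \<xi> * (indicator B y * k \<xi> y))"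
      using integrable_indicator_bounded(1)[OF ks _ fin C] by simp
    have mm: "(\<lambda>\<xi>. LINT y|lborel. norm (case (\<xi>, y) of (\<xi>, y) \<Rightarrow> g \<xi> * (indicator B y * k \<xi> y))) \<in> borel_measurable lborel"
      using m by (intro lborel.borel_measurable_lebesgue_integral) (auto simp: case_prod_beta)
    show "integrable lborel (\<lambda>\<xi>. LINT y|lborel. norm (case (\<xi>, y) of (\<xi>, y) \<Rightarrow> g \<xi> * (indicator B y * k \<xi> y)))"
    proof (rule Bochner_Integration.integrable_bound[OF _ mm])
      show "integrable lborel (\<lambda>\<xi>. C * measure lborel B * g \<xi>)" using g by simp
      have "norm (LINT y|lborel. norm (g \<xi> * (indicator B y * k \<xi> y))) \<le> norm (C * measure lborel B * g \<xi>)" for \<xi>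
      proof -
        have "C \<ge> 0" using C[of undefined undefined] by linarith
        have eq: "(LINT y|lborel. norm (g \<xi> * (indicator B y * k \<xi> y))) = \<bar>g \<xi>\<bar> * (LINT y|lborel. indicator B y * \<bar>k \<xi> y\<bar>)"
          by (simp add: abs_mult)
        have "\<bar>LINT y|lborel. indicator B y * \<bar>k \<xi> y\<bar>\<bar> \<le> C * measure lborel B"
          by (rule integrable_indicator_bounded) (use ks fin C in auto)
        from mult_left_mono[OF this abs_ge_zero[of "g \<xi>"]]
        have "\<bar>g \<xi>\<bar> * \<bar>LINT y|lborel. indicator B y * \<bar>k \<xi> y\<bar>\<bar> \<le> \<bar>g \<xi>\<bar> * (C * measure lborel B)" .
        then show ?thesis
          unfolding eq using \<open>C \<ge> 0\<close> by (simp add: abs_mult mult_ac)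
      qed
      then show "AE \<xi> in lborel. norm (LINT y|lborel. norm (case (\<xi>, y) of (\<xi>, y) \<Rightarrow> g \<xi> * (indicator B y * k \<xi> y)))
          \<le> norm (C * measure lborel B * g \<xi>)" by simp
    qed
  qed
  from lborel_pair.Fubini_integral[OF this]
  have "(LINT y|lborel. LINT \<xi>|lborel. g \<xi> * (indicator B y * k \<xi> y)) = (LINT \<xi>|lborel. g \<xi> * (LINT y|lborel. indicator B y * k \<xi> y))"
    by simp
  moreover have "(LINT \<xi>|lborel. g \<xi> * (indicator B y * k \<xi> y)) = indicator B y * (LINT \<xi>|lborel. g \<xi> * k \<xi> y)" for y
    unfolding mult.left_commute[of "g _"] by simp
  ultimately show ?thesis by simp
qed

text \<open>The test functions.  In the applications \<open>g\<close> is radial, so its Fourier transform \<open>f\<close> is a cosine integral.\<close>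

locale cohn_elkies =
  fixes f g :: "'a::euclidean_space \<Rightarrow> real" and r :: real
  assumes r_pos: "r > 0"
    and g_int: "integrable lborel g" and g_nonneg: "\<And>\<xi>. g \<xi> \<ge> 0"
    and f_fourier: "\<And>x. f x = (LINT \<xi>|lborel. g \<xi> * cos (2 * pi * (x \<bullet> \<xi>)))"
    and f_int: "integrable lborel f" and f_nonpos: "\<And>x. norm x \<ge> r \<Longrightarrow> f x \<le> 0"
    and f_total: "(LINT x|lborel. f x) > 0"
begin

lemma f_meas [measurable]: "f \<in> borel_measurable borel"
  using f_int by simp

lemma g_meas [measurable]: "g \<in> borel_measurable borel"
  using g_int by simp

lemma f_zero_nonneg: "f 0 \<ge> 0"
  unfolding f_fourier[of 0] using g_nonneg by (intro Bochner_Integration.integral_nonneg) simp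

lemma integrable_weight:
  assumes "k \<in> borel_measurable borel" "\<And>\<xi>. \<bar>k \<xi>\<bar> \<le> C"
  shows "integrable lborel (\<lambda>\<xi>. g \<xi> * k \<xi>)"
proof (rule Bochner_Integration.integrable_bound)
  show "integrable lborel (\<lambda>\<xi>. C * g \<xi>)" using g_int by simp
  show "(\<lambda>\<xi>. g \<xi> * k \<xi>) \<in> borel_measurable lborel" using assms(1) by simp
  have "C \<ge> 0" using assms(2)[of undefined] by linarith
  then show "AE \<xi> in lborel. norm (g \<xi> * k \<xi>) \<le> norm (C * g \<xi>)"
    using assms(2) by (intro AE_I2) (simp add: abs_mult mult.commute[of C] mult_left_mono)
qed

text \<open>The right-hand side is the integral of \<open>g\<close> against the squared modulus of the Fourier transform of the
measure \<open>\<mu> = (\<Sum>x\<in>X. \<delta> x) - l * (Lebesgue measure on B)\<close>; its real and imaginary part are the two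
squares in the proof.\<close>

lemma positive_definite:
  assumes fin: "finite X" and B[measurable]: "B \<in> sets borel" and Bfin: "emeasure lborel B < \<infinity>"
  shows "0 \<le> (\<Sum>x\<in>X. \<Sum>y\<in>X. f (x - y)) - 2 * l * (\<Sum>x\<in>X. LINT y|lborel. indicator B y * f (x - y))
      + l\<^sup>2 * (LINT y|lborel. indicator B y * (LINT z|lborel. indicator B z * f (y - z)))"
proof -
  let ?c = "\<lambda>(x::'a) \<xi>. cos (2 * pi * (x \<bullet> \<xi>))" and ?s = "\<lambda>(x::'a) \<xi>. sin (2 * pi * (x \<bullet> \<xi>))"
  define cB where "cB \<xi> = (LINT y|lborel. indicator B y * ?c y \<xi>)" for \<xi>
  define sB where "sB \<xi> = (LINT y|lborel. indicator B y * ?s y \<xi>)" for \<xi>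
  \<comment> \<open>\<open>W y\<close> is the average of the character \<open>?c (y - z)\<close> over \<open>z\<close> in the window, see \<open>W_eq\<close> below.\<close>
  define W where "W y \<xi> = ?c y \<xi> * cB \<xi> + ?s y \<xi> * sB \<xi>" for y \<xi>
  have diff: "?c (x - y) \<xi> = ?c x \<xi> * ?c y \<xi> + ?s x \<xi> * ?s y \<xi>" for x y \<xi>
    by (simp add: inner_diff_left right_diff_distrib cos_diff)
  have [measurable]: "cB \<in> borel_measurable borel" "sB \<in> borel_measurable borel"
    unfolding cB_def[abs_def] sB_def[abs_def] by measurable
  have Ic: "integrable lborel (\<lambda>y. indicator B y * ?c y \<xi>)" "\<bar>cB \<xi>\<bar> \<le> 1 * measure lborel B" for \<xi>
    using integrable_indicator_bounded[OF _ B Bfin, of "\<lambda>y. ?c y \<xi>" 1] unfolding cB_def by simp_all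
  have Is: "integrable lborel (\<lambda>y. indicator B y * ?s y \<xi>)" "\<bar>sB \<xi>\<bar> \<le> 1 * measure lborel B" for \<xi>
    using integrable_indicator_bounded[OF _ B Bfin, of "\<lambda>y. ?s y \<xi>" 1] unfolding sB_def by simp_all
  have W_eq: "W y \<xi> = (LINT z|lborel. indicator B z * ?c (y - z) \<xi>)" for y \<xi>
  proof -
    have "(LINT z|lborel. indicator B z * ?c (y - z) \<xi>)
        = (LINT z|lborel. ?c y \<xi> * (indicator B z * ?c z \<xi>) + ?s y \<xi> * (indicator B z * ?s z \<xi>))"
      unfolding diff by (intro Bochner_Integration.integral_cong) (auto simp: algebra_simps)
    also have "\<dots> = W y \<xi>" using Ic(1)[of \<xi>] Is(1)[of \<xi>] by (simp add: W_def cB_def sB_def)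
    finally show ?thesis ..
  qed
  have W_bound: "\<bar>W y \<xi>\<bar> \<le> measure lborel B" for y \<xi>
    unfolding W_eq using integrable_indicator_bounded(2)[OF _ B Bfin, of "\<lambda>z. ?c (y - z) \<xi>" 1] by simp
  have f_W: "(LINT \<xi>|lborel. g \<xi> * W y \<xi>) = (LINT z|lborel. indicator B z * f (y - z))" for y
  proof -
    have "(\<lambda>(\<xi>, z). ?c (y - z) \<xi>) \<in> borel_measurable (borel \<Otimes>\<^sub>M borel)" by measurable
    from integral_weight_swap[OF g_int B Bfin this, of 1] show ?thesis
      unfolding W_eq f_fourier by simp
  qed
  have WW: "(LINT y|lborel. indicator B y * W y \<xi>) = (cB \<xi>)\<^sup>2 + (sB \<xi>)\<^sup>2" for \<xi>
  proof -
    have "(LINT y|lborel. indicator B y * W y \<xi>)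
       = (LINT z|lborel. cB \<xi> * (indicator B z * ?c z \<xi>) + sB \<xi> * (indicator B z * ?s z \<xi>))"
      unfolding W_def by (intro Bochner_Integration.integral_cong) (auto simp: algebra_simps)
    also have "\<dots> = (cB \<xi>)\<^sup>2 + (sB \<xi>)\<^sup>2"
      using Ic(1)[of \<xi>] Is(1)[of \<xi>] by (simp add: cB_def sB_def power2_eq_square)
    finally show ?thesis .
  qed
  have f_WW: "(LINT \<xi>|lborel. g \<xi> * ((cB \<xi>)\<^sup>2 + (sB \<xi>)\<^sup>2)) = (LINT y|lborel. indicator B y * (LINT z|lborel. indicator B z * f (y - z)))"
  proof -
    have "(\<lambda>(\<xi>, y). W y \<xi>) \<in> borel_measurable (borel \<Otimes>\<^sub>M borel)" unfolding W_def by measurable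
    from integral_weight_swap[OF g_int B Bfin this W_bound]
    show ?thesis unfolding WW f_W .
  qed
  have "0 \<le> (LINT \<xi>|lborel. g \<xi> * (((\<Sum>x\<in>X. ?c x \<xi>) - l * cB \<xi>)\<^sup>2 + ((\<Sum>x\<in>X. ?s x \<xi>) - l * sB \<xi>)\<^sup>2))"
    using g_nonneg by (intro Bochner_Integration.integral_nonneg) simp
  also have "\<dots> = (LINT \<xi>|lborel. (\<Sum>x\<in>X. \<Sum>y\<in>X. g \<xi> * ?c (x - y) \<xi>) - 2 * l * (\<Sum>x\<in>X. g \<xi> * W x \<xi>)
      + l\<^sup>2 * (g \<xi> * ((cB \<xi>)\<^sup>2 + (sB \<xi>)\<^sup>2)))"
  proof (intro Bochner_Integration.integral_cong refl)
    fix \<xi>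
    have 1: "(\<Sum>x\<in>X. \<Sum>y\<in>X. ?c (x - y) \<xi>) = (\<Sum>x\<in>X. ?c x \<xi>)\<^sup>2 + (\<Sum>x\<in>X. ?s x \<xi>)\<^sup>2"
      unfolding diff by (simp add: sum.distrib power2_eq_square sum_product)
    have 2: "(\<Sum>x\<in>X. W x \<xi>) = (\<Sum>x\<in>X. ?c x \<xi>) * cB \<xi> + (\<Sum>x\<in>X. ?s x \<xi>) * sB \<xi>"
      unfolding W_def by (simp add: sum.distrib sum_distrib_right)
    show "g \<xi> * (((\<Sum>x\<in>X. ?c x \<xi>) - l * cB \<xi>)\<^sup>2 + ((\<Sum>x\<in>X. ?s x \<xi>) - l * sB \<xi>)\<^sup>2)
       = (\<Sum>x\<in>X. \<Sum>y\<in>X. g \<xi> * ?c (x - y) \<xi>) - 2 * l * (\<Sum>x\<in>X. g \<xi> * W x \<xi>)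
      + l\<^sup>2 * (g \<xi> * ((cB \<xi>)\<^sup>2 + (sB \<xi>)\<^sup>2))"
      unfolding sum_distrib_left[symmetric] 1 2 by (simp add: power2_eq_square algebra_simps)
  qed
  also have "\<dots> = (\<Sum>x\<in>X. \<Sum>y\<in>X. f (x - y)) - 2 * l * (\<Sum>x\<in>X. LINT y|lborel. indicator B y * f (x - y))
      + l\<^sup>2 * (LINT y|lborel. indicator B y * (LINT z|lborel. indicator B z * f (y - z)))"
  proof -
    have i1: "integrable lborel (\<lambda>\<xi>. g \<xi> * ?c z \<xi>)" for z
      by (rule integrable_weight[where C = 1]) auto
    have i2: "integrable lborel (\<lambda>\<xi>. g \<xi> * W z \<xi>)" for z
      by (rule integrable_weight[OF _ W_bound]) (simp add: W_def)
    have i3: "integrable lborel (\<lambda>\<xi>. g \<xi> * ((cB \<xi>)\<^sup>2 + (sB \<xi>)\<^sup>2))"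
    proof (rule integrable_weight)
      show "\<bar>(cB \<xi>)\<^sup>2 + (sB \<xi>)\<^sup>2\<bar> \<le> (measure lborel B)\<^sup>2 + (measure lborel B)\<^sup>2" for \<xi>
        using power_mono[OF Ic(2)[of \<xi>] abs_ge_zero, of 2] power_mono[OF Is(2)[of \<xi>] abs_ge_zero, of 2] by simp
    qed simp
    show ?thesis
      using i1 i2 i3 by (simp add: f_fourier[symmetric] f_W f_WW)
  qed
  finally show ?thesis .
qed

definition tail_mass :: "real \<Rightarrow> real" where
  "tail_mass K = (LINT y|lborel. indicator {y. norm y > K} y * \<bar>f y\<bar>)"

lemma tail_mass_small:
  assumes "e > 0"
  obtains K where "K > 0" "tail_mass K \<le> e"
proof -
  have "(\<lambda>n. LINT y|lborel. indicator {y. norm y > real n} y * \<bar>f y\<bar>) \<longlonglongrightarrow> (LINT y|(lborel::'a measure). 0)"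
  proof (rule integral_dominated_convergence[where w = "\<lambda>y. \<bar>f y\<bar>"])
    show "integrable lborel (\<lambda>y. \<bar>f y\<bar>)" using f_int by simp
    have "(\<lambda>n. indicator {y. norm y > real n} y * \<bar>f y\<bar>) \<longlonglongrightarrow> 0" for y :: 'a
    proof (rule tendsto_eventually)
      show "\<forall>\<^sub>F n in sequentially. indicator {y. norm y > real n} y * \<bar>f y\<bar> = 0"
        using eventually_ge_at_top[of "nat \<lceil>norm y\<rceil>"]
      proof eventually_elim
        case (elim n)
        then have "norm y \<le> real n" by linarith
        then show ?case by simp
      qed
    qed
    then show "AE y in lborel. (\<lambda>n. indicator {y. norm y > real n} y * \<bar>f y\<bar>) \<longlonglongrightarrow> 0" by simp
    show "AE y in lborel. norm (indicator {y. norm y > real n} y * \<bar>f y\<bar>) \<le> \<bar>f y\<bar>" for n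
      by (intro AE_I2) (simp add: indicator_def)
  qed measurable
  then have "(\<lambda>n. tail_mass (real n)) \<longlonglongrightarrow> 0" by (simp add: tail_mass_def)
  then have "\<forall>\<^sub>F n in sequentially. tail_mass (real n) < e"
    using assms by (rule order_tendstoD)
  then obtain n where "tail_mass (real n) < e" "n > 0"
    using eventually_gt_at_top[of 0] eventually_happens' sequentially_bot
    by (metis (mono_tags, lifting) eventually_conj)
  then show thesis using that[of "real n"] by simp
qed

text \<open>For \<open>y\<close> outside a window around \<open>x\<close>, the argument \<open>x - y\<close> lies in the tail of \<open>f\<close>.\<close>

lemma window_integral:
  assumes [measurable]: "B \<in> sets borel"
  shows "integrable lborel (\<lambda>y. indicator B y * f (x - y))"
    and "\<bar>LINT y|lborel. indicator B y * f (x - y)\<bar> \<le> (LINT y|lborel. \<bar>f y\<bar>)"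
    and "cball x K \<subseteq> B \<Longrightarrow>
      \<bar>(LINT y|lborel. f y) - (LINT y|lborel. indicator B y * f (x - y))\<bar> \<le> tail_mass K"
proof -
  have I: "integrable lborel (\<lambda>y. f (x - y))" using lborel_integral_reflect(2)[of f x] f_int by simp
  show J: "integrable lborel (\<lambda>y. indicator B y * f (x - y))"
    by (rule Bochner_Integration.integrable_bound[OF I]) (auto simp: indicator_def)
  have "\<bar>LINT y|lborel. indicator B y * f (x - y)\<bar> \<le> (LINT y|lborel. \<bar>indicator B y * f (x - y)\<bar>)"
    by (rule integral_abs_bound)
  also have "\<dots> \<le> (LINT y|lborel. \<bar>f (x - y)\<bar>)"
    using I J by (intro integral_mono) (auto simp: indicator_def)
  also have "\<dots> = (LINT y|lborel. \<bar>f y\<bar>)" by (rule lborel_integral_reflect) simp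
  finally show "\<bar>LINT y|lborel. indicator B y * f (x - y)\<bar> \<le> (LINT y|lborel. \<bar>f y\<bar>)" .
  assume K: "cball x K \<subseteq> B"
  have T: "integrable lborel (\<lambda>y. indicator {y. norm y > K} y * \<bar>f y\<bar>)"
    by (rule Bochner_Integration.integrable_bound[OF f_int]) (auto simp: indicator_def)
  have T': "integrable lborel (\<lambda>y. indicator {y. norm y > K} (x - y) * \<bar>f (x - y)\<bar>)"
    using lborel_integral_reflect(2)[of "\<lambda>y. indicator {y. norm y > K} y * \<bar>f y\<bar>" x] T by simp
  have "(LINT y|lborel. f y) = (LINT y|lborel. f (x - y))" by (rule lborel_integral_reflect(1)[symmetric]) simp
  then have "\<bar>(LINT y|lborel. f y) - (LINT y|lborel. indicator B y * f (x - y))\<bar>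
     = \<bar>LINT y|lborel. f (x - y) - indicator B y * f (x - y)\<bar>" using I J by simp
  also have "\<dots> \<le> (LINT y|lborel. \<bar>f (x - y) - indicator B y * f (x - y)\<bar>)" by (rule integral_abs_bound)
  also have "\<dots> \<le> (LINT y|lborel. indicator {y. norm y > K} (x - y) * \<bar>f (x - y)\<bar>)"
  proof (rule integral_mono)
    show "\<bar>f (x - y) - indicator B y * f (x - y)\<bar> \<le> indicator {y. norm y > K} (x - y) * \<bar>f (x - y)\<bar>" for y
      using K by (auto simp: indicator_def subset_eq dist_norm not_less)
  qed (use I J T' in auto)
  also have "\<dots> = tail_mass K"
    unfolding tail_mass_def by (rule lborel_integral_reflect(1)[of "\<lambda>y. indicator {y. norm y > K} y * \<bar>f y\<bar>"]) simp
  finally show "\<bar>(LINT y|lborel. f y) - (LINT y|lborel. indicator B y * f (x - y))\<bar> \<le> tail_mass K" .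
qed

text \<open>The window is larger than the ball with the points by a margin \<open>K\<close>, so that it sees almost the whole
integral of \<open>f\<close> from every point.  In the term that is quadratic in the window, the points of the margin
are estimated trivially; their share \<open>V' / V - 1\<close> tends to 0 when \<open>R\<close> grows and \<open>K\<close> is fixed.\<close>

lemma count_bound:
  fixes p :: 'a
  assumes R: "R > 0" and K: "K > 0" and fin: "finite X" and X: "X \<subseteq> cball p R"
    and sep: "\<And>x y. x \<in> X \<Longrightarrow> y \<in> X \<Longrightarrow> x \<noteq> y \<Longrightarrow> dist x y \<ge> r"
  defines "V \<equiv> measure lborel (cball p R)" and "V' \<equiv> measure lborel (cball p (R + K))"
  shows "real (card X) * ((LINT y|lborel. f y) - 3 * tail_mass K - (V' / V - 1) * (LINT y|lborel. \<bar>f y\<bar>)) \<le> f 0 * V"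
proof -
  let ?B = "cball p (R + K)" and ?C = "cball p R"
  let ?c = "LINT y|lborel. f y" and ?A = "LINT y|lborel. \<bar>f y\<bar>" and ?e = "tail_mass K" and ?N = "real (card X)"
  let ?I = "\<lambda>x. LINT y|lborel. indicator ?B y * f (x - y)"
  have [measurable]: "?B \<in> sets borel" "?C \<in> sets borel" by simp_all
  have fB: "emeasure lborel ?B < \<infinity>" and fC: "emeasure lborel ?C < \<infinity>"
    by (rule emeasure_lborel_cball_finite)+
  have V: "V > 0" unfolding V_def using R by (simp add: content_cball_pos)
  have VV': "V \<le> V'" unfolding V_def V'_def using K fB
    by (intro measure_mono_fmeasurable) (auto simp: fmeasurable_def)
  have inner: "cball x K \<subseteq> ?B" if "x \<in> ?C" for x
  proof
    fix y assume "y \<in> cball x K"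
    then show "y \<in> ?B" using that dist_triangle[of p y x] by simp
  qed
  note w = window_integral[OF \<open>?B \<in> sets borel\<close>]
  have I_ge: "?c - ?e \<le> ?I x" and I_le: "?I x \<le> ?c + ?e" if "x \<in> ?C" for x
    using w(3)[OF inner[OF that]] by linarith+
  \<comment> \<open>This value minimizes the quadratic polynomial in \<open>l\<close>, up to the error terms.\<close>
  define l where "l = ?N / V"
  have S1: "(\<Sum>x\<in>X. \<Sum>y\<in>X. f (x - y)) \<le> ?N * f 0"
  proof -
    have "(\<Sum>y\<in>X. f (x - y)) \<le> (\<Sum>y\<in>X. if y = x then f 0 else 0)" if "x \<in> X" for x
      by (rule sum_mono) (use sep[OF that] in \<open>auto simp: dist_norm intro!: f_nonpos\<close>)
    then have "(\<Sum>x\<in>X. \<Sum>y\<in>X. f (x - y)) \<le> (\<Sum>x\<in>X. f 0)"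
      using fin by (intro sum_mono) (fastforce simp: sum.delta)
    then show ?thesis by simp
  qed
  have S2: "?N * (?c - ?e) \<le> (\<Sum>x\<in>X. ?I x)"
  proof -
    have "(\<Sum>x\<in>X. ?c - ?e) \<le> (\<Sum>x\<in>X. ?I x)" by (rule sum_mono) (use I_ge X in blast)
    then show ?thesis by simp
  qed
  have I_meas[measurable]: "?I \<in> borel_measurable borel" by measurable
  have S3: "(LINT y|lborel. indicator ?B y * ?I y) \<le> V * (?c + ?e) + (V' - V) * ?A"
  proof -
    have "(LINT y|lborel. indicator ?B y * ?I y)
        \<le> (LINT y|lborel. (?c + ?e) * indicator ?C y + ?A * (indicator ?B y - indicator ?C y))"
    proof (rule integral_mono)
      show "integrable lborel (\<lambda>y. indicator ?B y * ?I y)"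
        by (rule integrable_indicator_bounded(1)[OF _ _ fB w(2)]) auto
      show "integrable lborel (\<lambda>y. (?c + ?e) * indicator ?C y + ?A * (indicator ?B y - indicator ?C y))"
        using fB fC by simp
      fix y :: 'a
      have "?I y \<le> ?A" using w(2)[of y] by linarith
      then show "indicator ?B y * ?I y \<le> (?c + ?e) * indicator ?C y + ?A * (indicator ?B y - indicator ?C y)"
        using I_le[of y] K by (auto simp: indicator_def)
    qed
    also have "\<dots> = V * (?c + ?e) + (V' - V) * ?A"
      using fB fC by (simp add: V_def V'_def mult.commute)
    finally show ?thesis .
  qed
  have "0 \<le> ?N * f 0 - 2 * l * (?N * (?c - ?e)) + l\<^sup>2 * (V * (?c + ?e) + (V' - V) * ?A)"
  proof -
    have "l \<ge> 0" using V by (simp add: l_def)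
    then have "2 * l * (?N * (?c - ?e)) \<le> 2 * l * (\<Sum>x\<in>X. ?I x)"
      and "l\<^sup>2 * (LINT y|lborel. indicator ?B y * ?I y) \<le> l\<^sup>2 * (V * (?c + ?e) + (V' - V) * ?A)"
      using S2 S3 by (auto intro!: mult_left_mono)
    then show ?thesis using positive_definite[OF fin \<open>?B \<in> sets borel\<close> fB, of l] S1 by linarith
  qed
  also have "\<dots> = (?N / V) * (f 0 * V - ?N * (?c - 3 * ?e - (V' / V - 1) * ?A))"
    using V by (simp add: l_def field_simps power2_eq_square)
  finally have "0 \<le> (?N / V) * (f 0 * V - ?N * (?c - 3 * ?e - (V' / V - 1) * ?A))" .
  then show ?thesis
  proof (cases "card X = 0")
    case True
    then show ?thesis using f_zero_nonneg V by simp
  next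
    case False
    then have "?N / V > 0" using V by simp
    then have "\<not> f 0 * V - ?N * (?c - 3 * ?e - (V' / V - 1) * ?A) < 0"
      using mult_pos_neg \<open>0 \<le> (?N / V) * _\<close> by (meson not_less)
    then show ?thesis by linarith
  qed
qed

end

section \<open>Densities of packings\<close>

lemma tendsto_one_plus_inverse:
  "((\<lambda>R::real. 1 + a / (R + b)) \<longlongrightarrow> 1) at_top"
proof -
  have "filterlim (\<lambda>R::real. b + R) at_top at_top"
    by (rule filterlim_tendsto_add_at_top[OF tendsto_const filterlim_ident])
  then have "((\<lambda>R. a / (R + b)) \<longlongrightarrow> 0) at_top"
    by (intro tendsto_divide_0[OF tendsto_const] filterlim_at_top_imp_at_infinity) (simp add: add.commute)
  from tendsto_add[OF tendsto_const this, of 1] show ?thesis by simp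
qed

lemma tendsto_shifted_ratio:
  "((\<lambda>R::real. (R + a) / R) \<longlongrightarrow> 1) at_top"
proof (rule Lim_transform_eventually)
  show "((\<lambda>R. 1 + a / (R + 0)) \<longlongrightarrow> 1) at_top" by (rule tendsto_one_plus_inverse)
  show "\<forall>\<^sub>F R in at_top. 1 + a / (R + 0) = (R + a) / R"
    using eventually_gt_at_top[of 0] by eventually_elim (simp add: field_simps)
qed

lemma finite_separated:
  fixes X :: "'a::euclidean_space set" and p :: 'a
  assumes d: "d > 0" and X: "X \<subseteq> cball p R"
    and sep: "\<And>x y. x \<in> X \<Longrightarrow> y \<in> X \<Longrightarrow> x \<noteq> y \<Longrightarrow> dist x y \<ge> d"
  shows "finite X"
proof -
  have "closed X"
  proof (rule discrete_imp_closed[OF d], intro ballI impI)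
    fix x y assume "x \<in> X" "y \<in> X" "dist y x < d"
    then show "y = x" using sep[of y x] by linarith
  qed
  moreover have "bounded X" using X bounded_cball bounded_subset by blast
  ultimately have comp: "compact X" by (simp add: compact_eq_bounded_closed)
  have "X \<subseteq> (\<Union>x\<in>X. ball x d)" using d by auto
  then obtain Y where Y: "Y \<subseteq> X" "finite Y" "X \<subseteq> (\<Union>x\<in>Y. ball x d)"
    using compactE_image[OF comp, of X "\<lambda>x. ball x d"] open_ball by metis
  have "X \<subseteq> Y"
  proof
    fix x assume x: "x \<in> X"
    then obtain y where y: "y \<in> Y" "dist y x < d" using Y(3) by auto
    have "y = x"
    proof (rule ccontr)
      assume "y \<noteq> x"
      with sep[of y x] x y Y(1) show False by auto
    qed
    then show "x \<in> Y" using y by simp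
  qed
  then show ?thesis using Y(2) finite_subset by blast
qed

text \<open>Two balls whose centers are closer than \<open>2 * \<rho>\<close> have the midpoint of the centers as a common interior
point.\<close>

lemma sphere_packing_centers:
  fixes P :: "'a::euclidean_space set set"
  assumes "sphere_packing P"
  obtains \<rho> C where "\<rho> > 0" "P = (\<lambda>c. cball c \<rho>) ` C"
    "\<And>c c'. c \<in> C \<Longrightarrow> c' \<in> C \<Longrightarrow> c \<noteq> c' \<Longrightarrow> dist c c' \<ge> 2 * \<rho>"
proof -
  have "\<exists>r>0. \<forall>B\<in>P. \<exists>c. B = cball c r"
    and disj: "\<forall>B\<in>P. \<forall>B'\<in>P. B \<noteq> B' \<longrightarrow> B \<inter> B' \<subseteq> frontier B \<inter> frontier B'"
    using assms unfolding sphere_packing_def by (rule conjunct1, rule conjunct2)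
  then obtain \<rho> where \<rho>: "\<rho> > 0" "\<forall>B\<in>P. \<exists>c. B = cball c \<rho>" by (elim exE conjE)
  define C where "C = {c. cball c \<rho> \<in> P}"
  show thesis
  proof (rule that[OF \<rho>(1), of C])
    show "P = (\<lambda>c. cball c \<rho>) ` C" using \<rho>(2) unfolding C_def by auto
    fix c c' assume cc: "c \<in> C" "c' \<in> C" "c \<noteq> c'"
    show "dist c c' \<ge> 2 * \<rho>"
    proof (rule ccontr)
      assume "\<not> dist c c' \<ge> 2 * \<rho>"
      then have m: "dist c (midpoint c c') < \<rho>" "dist c' (midpoint c c') < \<rho>"
        by (simp_all add: dist_midpoint)
      have "cball c \<rho> \<noteq> cball c' \<rho>" using cc \<rho>(1) by (auto simp: cball_eq_cball_iff)
      with disj[rule_format, of "cball c \<rho>" "cball c' \<rho>"] cc(1,2)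
      have "cball c \<rho> \<inter> cball c' \<rho> \<subseteq> frontier (cball c \<rho>)" unfolding C_def by simp
      moreover have "midpoint c c' \<in> cball c \<rho> \<inter> cball c' \<rho>" using m by simp
      ultimately have "midpoint c c' \<in> sphere c \<rho>" by (auto simp: frontier_cball)
      with m show False by simp
    qed
  qed
qed

lemma emeasure_lborel_cball_ennreal:
  fixes c :: "'a::euclidean_space"
  assumes "R \<ge> 0"
  shows "emeasure lborel (cball c R) = ennreal (unit_ball_vol (real DIM('a)) * R ^ DIM('a))"
  using emeasure_cball[OF assms, of c] by simp

context cohn_elkies
begin

text \<open>Dilating the centers by \<open>\<sigma>\<close> makes their distances at least \<open>r\<close>.\<close>

lemma packing_count_bound:
  fixes p :: 'a
  assumes K: "K > 0" and \<rho>: "\<rho> > 0" and R: "R > 0"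
    and sep: "\<And>c c'. c \<in> C \<Longrightarrow> c' \<in> C \<Longrightarrow> c \<noteq> c' \<Longrightarrow> dist c c' \<ge> 2 * \<rho>"
  defines "\<sigma> \<equiv> r / (2 * \<rho>)"
  shows "finite (C \<inter> cball p R)"
    and "real (card (C \<inter> cball p R)) * ((LINT y|lborel. f y) - 3 * tail_mass K
        - (((1 + (K / \<sigma>) / R)) ^ DIM('a) - 1) * (LINT y|lborel. \<bar>f y\<bar>)) \<le> f 0 * (unit_ball_vol DIM('a) * (\<sigma> * R) ^ DIM('a))"
proof -
  let ?X = "C \<inter> cball p R"
  show fin: "finite ?X"
    by (rule finite_separated[of "2 * \<rho>" _ p R]) (use \<rho> sep in auto)
  have \<sigma>: "\<sigma> > 0" using \<rho> r_pos by (simp add: \<sigma>_def)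
  let ?Y = "(*\<^sub>R) \<sigma> ` ?X"
  have card: "card ?Y = card ?X" using \<sigma> by (intro card_image) (auto simp: inj_on_def)
  have dist: "dist (\<sigma> *\<^sub>R x) (\<sigma> *\<^sub>R y) = \<sigma> * dist x y" for x y :: 'a
    using \<sigma> by (simp add: dist_norm flip: scaleR_diff_right)
  have "real (card ?Y) * ((LINT y|lborel. f y) - 3 * tail_mass K
      - (measure lborel (cball (\<sigma> *\<^sub>R p) (\<sigma> * R + K)) / measure lborel (cball (\<sigma> *\<^sub>R p) (\<sigma> * R)) - 1) * (LINT y|lborel. \<bar>f y\<bar>))
      \<le> f 0 * measure lborel (cball (\<sigma> *\<^sub>R p) (\<sigma> * R))"
  proof (rule count_bound[OF _ K])
    show "?Y \<subseteq> cball (\<sigma> *\<^sub>R p) (\<sigma> * R)" using \<sigma> by (auto simp: dist)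
    fix x y assume "x \<in> ?Y" "y \<in> ?Y" "x \<noteq> y"
    then obtain a b where ab: "a \<in> C" "b \<in> C" "a \<noteq> b" "x = \<sigma> *\<^sub>R a" "y = \<sigma> *\<^sub>R b" by auto
    have "r = \<sigma> * (2 * \<rho>)" using \<rho> by (simp add: \<sigma>_def)
    also have "\<dots> \<le> \<sigma> * dist a b" using \<sigma> sep[OF ab(1-3)] by (intro mult_left_mono) auto
    finally show "dist x y \<ge> r" by (simp add: ab dist)
  qed (use \<sigma> R fin in auto)
  moreover have "measure lborel (cball (\<sigma> *\<^sub>R p) (\<sigma> * R)) = unit_ball_vol DIM('a) * (\<sigma> * R) ^ DIM('a)"
    using \<sigma> R by (intro content_cball) simp
  moreover have "measure lborel (cball (\<sigma> *\<^sub>R p) (\<sigma> * R + K)) = unit_ball_vol DIM('a) * (\<sigma> * R + K) ^ DIM('a)"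
    using \<sigma> R K by (intro content_cball) simp
  moreover have "unit_ball_vol DIM('a) * (\<sigma> * R + K) ^ DIM('a) / (unit_ball_vol DIM('a) * (\<sigma> * R) ^ DIM('a)) = (1 + (K / \<sigma>) / R) ^ DIM('a)"
  proof -
    have w: "unit_ball_vol (real DIM('a)) \<noteq> 0" using unit_ball_vol_pos[of "real DIM('a)"] by linarith
    then have "unit_ball_vol DIM('a) * (\<sigma> * R + K) ^ DIM('a) / (unit_ball_vol DIM('a) * (\<sigma> * R) ^ DIM('a)) = ((\<sigma> * R + K) / (\<sigma> * R)) ^ DIM('a)"
      by (simp add: power_divide w)
    also have "(\<sigma> * R + K) / (\<sigma> * R) = 1 + (K / \<sigma>) / R" using \<sigma> R by (simp add: field_simps)
    finally show ?thesis .
  qed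
  ultimately show "real (card ?X) * ((LINT y|lborel. f y) - 3 * tail_mass K
        - (((1 + (K / \<sigma>) / R)) ^ DIM('a) - 1) * (LINT y|lborel. \<bar>f y\<bar>)) \<le> f 0 * (unit_ball_vol DIM('a) * (\<sigma> * R) ^ DIM('a))"
    by (simp add: card)
qed

text \<open>The bound is that of a packing by balls of radius \<open>r / 2\<close> with \<open>f 0 / c\<close> centers per unit volume, where
\<open>c\<close> is the integral of \<open>f\<close>.\<close>

theorem packing_density_le:
  assumes "sphere_packing (P :: 'a set set)"
  shows "packing_density P \<le> ennreal (f 0 / (LINT y|lborel. f y) * (unit_ball_vol DIM('a) * (r / 2) ^ DIM('a)))"
proof (rule ennreal_le_epsilon)
  let ?n = "DIM('a)" and ?c = "LINT y|lborel. f y" and ?A = "LINT y|lborel. \<bar>f y\<bar>" and ?w = "unit_ball_vol (real DIM('a))"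
  let ?L = "f 0 / ?c * (?w * (r / 2) ^ ?n)"
  fix e :: real assume e: "e > 0"
  obtain \<rho> C where \<rho>: "\<rho> > 0" and P: "P = (\<lambda>c. cball c \<rho>) ` C"
    and sep: "\<And>c c'. c \<in> C \<Longrightarrow> c' \<in> C \<Longrightarrow> c \<noteq> c' \<Longrightarrow> dist c c' \<ge> 2 * \<rho>"
    using sphere_packing_centers[OF assms] by blast
  define \<sigma> where "\<sigma> = r / (2 * \<rho>)"
  have \<sigma>: "\<sigma> > 0" "\<sigma> * \<rho> = r / 2" using \<rho> r_pos by (simp_all add: \<sigma>_def)
  have w: "?w > 0" "?w \<noteq> 0" using unit_ball_vol_pos[of "real ?n"] by linarith+
  have L0: "?L \<ge> 0" using f_zero_nonneg f_total r_pos w by (intro mult_nonneg_nonneg) auto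
  let ?M = "f 0 * (?w * (r / 2) ^ ?n)"
  have M0: "?M \<ge> 0" using f_zero_nonneg r_pos w by (intro mult_nonneg_nonneg) auto
  have "((\<lambda>t. ?M / (?c - 3 * t)) \<longlongrightarrow> ?M / (?c - 3 * 0)) (at_right 0)"
    using f_total by (intro tendsto_intros) auto
  then have "\<forall>\<^sub>F t in at_right 0. ?M / (?c - 3 * t) < ?L + e"
    by (rule order_tendstoD) (use e in simp)
  moreover have "\<forall>\<^sub>F t in at_right (0::real). t < ?c / 3"
    using f_total by (intro order_tendstoD(2)[OF tendsto_ident_at]) simp
  moreover have "\<forall>\<^sub>F t in at_right (0::real). t > 0" by (rule eventually_at_right_less)
  ultimately have "\<forall>\<^sub>F t in at_right 0. ?M / (?c - 3 * t) < ?L + e \<and> t < ?c / 3 \<and> t > 0"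
    by eventually_elim simp
  then obtain t where t: "?M / (?c - 3 * t) < ?L + e" "t < ?c / 3" "t > 0"
    using eventually_happens'[OF trivial_limit_at_right_real] by blast
  obtain K where K: "K > 0" "tail_mass K \<le> t" using tail_mass_small[OF t(3)] by blast
  \<comment> \<open>Only balls with center in the ball of radius \<open>R + \<rho>\<close> can meet the ball of radius \<open>R\<close>.\<close>
  let ?D = "\<lambda>R. ?c - 3 * t - ((1 + (K / \<sigma>) / (R + \<rho>)) ^ ?n - 1) * ?A"
  from tendsto_power[OF tendsto_one_plus_inverse[of "K / \<sigma>" \<rho>], of ?n]
  have "((\<lambda>R. ((1 + (K / \<sigma>) / (R + \<rho>)) ^ ?n - 1) * ?A) \<longlongrightarrow> (1 ^ ?n - 1) * ?A) at_top"
    by (intro tendsto_mult tendsto_diff tendsto_const)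
  then have Dlim: "(?D \<longlongrightarrow> ?c - 3 * t - (1 ^ ?n - 1) * ?A) at_top" by (intro tendsto_diff tendsto_const)
  from tendsto_power[OF tendsto_shifted_ratio[of \<rho>], of ?n]
  have "((\<lambda>R. ?M * ((R + \<rho>) / R) ^ ?n / ?D R) \<longlongrightarrow> ?M * 1 ^ ?n / (?c - 3 * t - (1 ^ ?n - 1) * ?A)) at_top"
    using t(2) by (intro tendsto_divide tendsto_mult[OF tendsto_const] Dlim) auto
  then have ev1: "\<forall>\<^sub>F R in at_top. ?M * ((R + \<rho>) / R) ^ ?n / ?D R < ?L + e"
    by (rule order_tendstoD) (use t(1) in simp)
  have ev2: "\<forall>\<^sub>F R in at_top. ?D R > 0"
    by (rule order_tendstoD[OF Dlim]) (use t(2) in simp)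
  have "\<forall>\<^sub>F R in at_top. (SUP p. emeasure lborel (cball p R \<inter> \<Union>P) / emeasure lborel (cball p R)) \<le> ennreal (?L + e)"
    using ev1 ev2 eventually_gt_at_top[of 0]
  proof eventually_elim
    case (elim R)
    show ?case
    proof (rule SUP_least)
      fix p :: 'a
      let ?X = "C \<inter> cball p (R + \<rho>)" and ?N = "real (card (C \<inter> cball p (R + \<rho>)))"
      have R': "R + \<rho> > 0" using elim \<rho> by simp
      note pc = packing_count_bound[OF K(1) \<rho> R' sep, of C p, folded \<sigma>_def]
      have fin: "finite ?X" using pc(1) by blast
      have "?N * ?D R \<le> ?N * (?c - 3 * tail_mass K - ((1 + (K / \<sigma>) / (R + \<rho>)) ^ ?n - 1) * ?A)"
        using K(2) by (intro mult_left_mono) auto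
      also have "\<dots> \<le> f 0 * (?w * (\<sigma> * (R + \<rho>)) ^ ?n)" using pc(2) by blast
      finally have N: "?N \<le> f 0 * (?w * (\<sigma> * (R + \<rho>)) ^ ?n) / ?D R"
        using elim(2) by (simp add: pos_le_divide_eq)
      have "?N * (?w * \<rho> ^ ?n) \<le> (f 0 * (?w * (\<sigma> * (R + \<rho>)) ^ ?n) / ?D R) * (?w * \<rho> ^ ?n)"
        using N w \<rho> by (intro mult_right_mono) auto
      also have "\<dots> = (?M * ((R + \<rho>) / R) ^ ?n / ?D R) * (?w * R ^ ?n)"
        unfolding \<sigma>(2)[symmetric] using elim(3) by (simp add: power_mult_distrib power_divide)
      also have "\<dots> \<le> (?L + e) * (?w * R ^ ?n)"
        using elim w by (intro mult_right_mono) auto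
      finally have N2: "?N * (?w * \<rho> ^ ?n) \<le> (?L + e) * (?w * R ^ ?n)" .
      have "cball p R \<inter> \<Union>P \<subseteq> (\<Union>c\<in>?X. cball c \<rho>)"
      proof
        fix x assume "x \<in> cball p R \<inter> \<Union>P"
        then obtain c where "c \<in> C" "dist c x \<le> \<rho>" "dist p x \<le> R" unfolding P by auto
        moreover have "dist p c \<le> dist p x + dist c x" by (metis dist_commute dist_triangle)
        ultimately show "x \<in> (\<Union>c\<in>?X. cball c \<rho>)" by auto
      qed
      then have "emeasure lborel (cball p R \<inter> \<Union>P) \<le> emeasure lborel (\<Union>c\<in>?X. cball c \<rho>)"
        using fin by (intro emeasure_mono) auto
      also have "\<dots> \<le> (\<Sum>c\<in>?X. emeasure lborel (cball c \<rho>))"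
        using fin by (intro emeasure_subadditive_finite) auto
      also have "\<dots> = ennreal (?N * (?w * \<rho> ^ ?n))"
        using \<rho> w by (simp add: emeasure_lborel_cball_ennreal ennreal_mult' ennreal_of_nat_eq_real_of_nat)
      also have "\<dots> \<le> ennreal ((?L + e) * (?w * R ^ ?n))" by (rule ennreal_leI[OF N2])
      finally have "emeasure lborel (cball p R \<inter> \<Union>P) / emeasure lborel (cball p R)
          \<le> ennreal ((?L + e) * (?w * R ^ ?n)) / ennreal (?w * R ^ ?n)"
        using elim(3) by (simp add: emeasure_lborel_cball_ennreal divide_right_mono_ennreal)
      also have "\<dots> = ennreal (?L + e)"
        using elim(3) w(1) L0 e by (subst divide_ennreal) (auto simp: w(2))
      finally show "emeasure lborel (cball p R \<inter> \<Union>P) / emeasure lborel (cball p R) \<le> ennreal (?L + e)" .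
    qed
  qed
  then have "packing_density P \<le> ennreal (?L + e)"
    unfolding packing_density_def by (rule Limsup_bounded)
  also have "\<dots> = ennreal ?L + ennreal e" using L0 e by (intro ennreal_plus) auto
  finally show "packing_density P \<le> ennreal ?L + ennreal e" .
qed

end

text \<open>The balls of radius \<open>\<rho>\<close> about the lattice points within \<open>R - \<rho>\<close> are disjoint and lie in the ball of
radius \<open>R\<close>.  There are at least as many such points as the volume of the ball of radius
\<open>R - \<rho> - D\<close>, because their translates of \<open>F\<close> cover it.\<close>

lemma lattice_packing_density_ge:
  fixes \<Lambda> F :: "'a::euclidean_space set"
  assumes countable: "countable \<Lambda>" and F: "F \<in> sets borel" "F \<subseteq> cball 0 D" "emeasure lborel F \<le> 1"
    and cover: "\<And>x. \<exists>v\<in>\<Lambda>. x - v \<in> F"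
    and \<rho>: "\<rho> > 0" and sep: "\<And>v w. v \<in> \<Lambda> \<Longrightarrow> w \<in> \<Lambda> \<Longrightarrow> v \<noteq> w \<Longrightarrow> dist v w \<ge> 2 * \<rho>"
    and ml: "2 * \<rho> \<le> min_length \<Lambda>"
  shows "ennreal (unit_ball_vol DIM('a) * \<rho> ^ DIM('a)) \<le> packing_density (lattice_packing \<Lambda>)"
proof -
  let ?n = "DIM('a)" and ?w = "unit_ball_vol (real DIM('a))" and ?P = "lattice_packing \<Lambda>"
  have w: "?w > 0" "?w \<noteq> 0" using unit_ball_vol_pos[of "real ?n"] by linarith+
  have ev: "\<forall>\<^sub>F R in at_top. ennreal (?w * \<rho> ^ ?n * ((R - \<rho> - D) / R) ^ ?n)
      \<le> (SUP p. emeasure lborel (cball p R \<inter> \<Union>?P) / emeasure lborel (cball p R))"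
    using eventually_gt_at_top[of 0] eventually_gt_at_top[of "\<rho> + D"]
  proof eventually_elim
    case (elim R)
    let ?N = "\<Lambda> \<inter> cball 0 (R - \<rho>)"
    have fin: "finite ?N" by (rule finite_separated[of "2 * \<rho>" _ 0 "R - \<rho>"]) (use \<rho> sep in auto)
    have shift_meas: "(+) v ` F \<in> sets borel" for v
    proof -
      have "(+) v ` F = (\<lambda>x. x - v) -` F"
        by (auto simp: image_iff) (metis add.commute diff_add_cancel)
      then show ?thesis using F(1) by (auto intro!: measurable_sets_borel[of _ borel])
    qed
    have "cball 0 (R - \<rho> - D) \<subseteq> (\<Union>v\<in>?N. (+) v ` F)"
    proof
      fix x :: 'a assume x: "x \<in> cball 0 (R - \<rho> - D)"
      obtain v where v: "v \<in> \<Lambda>" "x - v \<in> F" using cover by blast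
      have "norm (x - v) \<le> D" using v(2) F(2) by auto
      then have "norm v \<le> R - \<rho>" using x norm_triangle_ineq4[of x "x - v"] by simp
      moreover have "x \<in> (+) v ` F" using v(2) by (intro image_eqI[of _ _ "x - v"]) auto
      ultimately show "x \<in> (\<Union>v\<in>?N. (+) v ` F)" using v(1) by auto
    qed
    then have "emeasure lborel (cball (0::'a) (R - \<rho> - D)) \<le> emeasure lborel (\<Union>v\<in>?N. (+) v ` F)"
      using fin shift_meas by (intro emeasure_mono) auto
    also have "\<dots> \<le> (\<Sum>v\<in>?N. emeasure lborel ((+) v ` F))"
      using fin shift_meas by (intro emeasure_subadditive_finite) auto
    also have "\<dots> \<le> of_nat (card ?N)"
      using F(3) sum_mono[of ?N "\<lambda>v. emeasure lborel ((+) v ` F)" "\<lambda>_. 1"] by (simp add: lborel_shift[OF F(1)])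
    finally have N: "ennreal (?w * (R - \<rho> - D) ^ ?n) \<le> ennreal (real (card ?N))"
      using elim by (simp add: emeasure_lborel_cball_ennreal ennreal_of_nat_eq_real_of_nat)
    then have N': "?w * (R - \<rho> - D) ^ ?n \<le> real (card ?N)" by simp
    have disj: "disjoint_family_on (\<lambda>v. ball v \<rho>) ?N"
      unfolding disjoint_family_on_def
    proof (intro ballI impI equals0I)
      fix v u x assume vu: "v \<in> ?N" "u \<in> ?N" "v \<noteq> u" "x \<in> ball v \<rho> \<inter> ball u \<rho>"
      then have "dist v u < 2 * \<rho>" using dist_triangle[of v u x] by (simp add: dist_commute)
      with sep[of v u] vu show False by auto
    qed
    have PP: "\<Union>?P \<in> sets borel"
      unfolding lattice_packing_def using countable by (intro sets.countable_Union) auto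
    have "ennreal (real (card ?N) * (?w * \<rho> ^ ?n)) = (\<Sum>v\<in>?N. emeasure lborel (ball v \<rho>))"
      using \<rho> w by (simp add: emeasure_ball ennreal_mult' ennreal_of_nat_eq_real_of_nat)
    also have "\<dots> = emeasure lborel (\<Union>v\<in>?N. ball v \<rho>)"
      using fin disj by (intro sum_emeasure) auto
    also have "\<dots> \<le> emeasure lborel (cball 0 R \<inter> \<Union>?P)"
    proof (rule emeasure_mono)
      show "(\<Union>v\<in>?N. ball v \<rho>) \<subseteq> cball 0 R \<inter> \<Union>?P"
      proof
        fix x assume "x \<in> (\<Union>v\<in>?N. ball v \<rho>)"
        then obtain v where v: "v \<in> \<Lambda>" "norm v \<le> R - \<rho>" "dist v x < \<rho>" by auto
        have "norm x \<le> R" using v norm_triangle_ineq[of v "x - v"] by (simp add: dist_norm norm_minus_commute)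
        moreover have "x \<in> cball v (min_length \<Lambda> / 2)" using v ml by simp
        ultimately show "x \<in> cball 0 R \<inter> \<Union>?P" using v(1) unfolding lattice_packing_def by auto
      qed
    qed (use PP in auto)
    finally have V: "ennreal (real (card ?N) * (?w * \<rho> ^ ?n)) \<le> emeasure lborel (cball 0 R \<inter> \<Union>?P)" .
    have "?w * \<rho> ^ ?n * ((R - \<rho> - D) / R) ^ ?n = (?w * (R - \<rho> - D) ^ ?n) * (?w * \<rho> ^ ?n) / (?w * R ^ ?n)"
      by (simp add: power_divide w(2))
    also have "\<dots> \<le> real (card ?N) * (?w * \<rho> ^ ?n) / (?w * R ^ ?n)"
      using N' w \<rho> elim by (intro divide_right_mono mult_right_mono) auto
    finally have "ennreal (?w * \<rho> ^ ?n * ((R - \<rho> - D) / R) ^ ?n) \<le> ennreal (real (card ?N) * (?w * \<rho> ^ ?n) / (?w * R ^ ?n))"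
      by (rule ennreal_leI)
    also have "\<dots> = ennreal (real (card ?N) * (?w * \<rho> ^ ?n)) / ennreal (?w * R ^ ?n)"
      using w \<rho> elim by (intro divide_ennreal[symmetric]) auto
    also have "\<dots> \<le> emeasure lborel (cball 0 R \<inter> \<Union>?P) / emeasure lborel (cball (0::'a) R)"
      using V elim by (simp add: emeasure_lborel_cball_ennreal divide_right_mono_ennreal)
    also have "\<dots> \<le> (SUP p. emeasure lborel (cball p R \<inter> \<Union>?P) / emeasure lborel (cball p R))"
      by (rule SUP_upper) simp
    finally show ?case .
  qed
  have "((\<lambda>R. (R - \<rho> - D) / R) \<longlongrightarrow> 1) at_top"
    using tendsto_shifted_ratio[of "- \<rho> - D"] by (simp add: algebra_simps)
  from tendsto_power[OF this, of ?n]
  have "((\<lambda>R. ennreal (?w * \<rho> ^ ?n * ((R - \<rho> - D) / R) ^ ?n)) \<longlongrightarrow> ennreal (?w * \<rho> ^ ?n * 1 ^ ?n)) at_top"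
    by (intro tendsto_ennrealI tendsto_mult tendsto_const)
  then have "ennreal (?w * \<rho> ^ ?n) = Limsup at_top (\<lambda>R. ennreal (?w * \<rho> ^ ?n * ((R - \<rho> - D) / R) ^ ?n))"
    by (subst lim_imp_Limsup) auto
  also have "\<dots> \<le> packing_density ?P"
    unfolding packing_density_def by (rule Limsup_mono[OF ev])
  finally show ?thesis .
qed

lemma min_length_ge:
  assumes "\<Lambda> - {0} \<noteq> {}" "\<And>v. v \<in> \<Lambda> \<Longrightarrow> v \<noteq> 0 \<Longrightarrow> norm v \<ge> m"
  shows "min_length \<Lambda> \<ge> m"
  unfolding min_length_def using assms by (intro cInf_greatest) auto

section \<open>Test functions that are polynomials times Gaussians\<close>

lemma gaussian_poly_zero: "gaussian_poly \<alpha> p 0 = coeff p 0 / fact \<alpha>"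
  by (simp add: gaussian_poly_def poly_0_coeff_0 coeff_borel_transform)

text \<open>Since the substitution is an involution, the integral of \<open>f\<close> is given by the constant coefficient of \<open>p\<close>;
the value of \<open>f\<close> at 0 is given by the constant coefficient \<open>poly p 1\<close> of \<open>pcompose p [:1, -1:]\<close>.\<close>

lemma gaussian_cohn_elkies:
  fixes p :: "real poly"
  assumes dim: "DIM('a::euclidean_space) = 2 * (\<alpha> + 1)" and u0: "u0 > 0" and p0: "coeff p 0 > 0"
    and nonneg: "\<And>u. u \<ge> 0 \<Longrightarrow> poly (borel_transform \<alpha> p) u \<ge> 0"
    and nonpos: "\<And>u. u \<ge> u0 \<Longrightarrow> poly (borel_transform \<alpha> (pcompose p [:1, -1:])) u \<le> 0"
    and P: "sphere_packing (P :: 'a set set)"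
  shows "packing_density P \<le> ennreal (poly p 1 / coeff p 0 * (unit_ball_vol DIM('a) * (u0 / (4 * pi)) ^ (\<alpha> + 1)))"
proof -
  let ?q = "pcompose p [:1, -1:]"
  let ?f = "gaussian_poly \<alpha> ?q :: 'a \<Rightarrow> real" and ?g = "gaussian_poly \<alpha> p :: 'a \<Rightarrow> real" and ?r = "sqrt (u0 / pi)"
  have qq: "pcompose ?q [:1, -1:] = p"
    by (simp add: pcompose_assoc[symmetric] pcompose_pCons)
  have total: "(LINT x|lborel. ?f x) = coeff p 0 / fact \<alpha>"
    using gaussian_poly_fourier[OF dim, of ?q 0] by (simp add: qq gaussian_poly_zero)
  interpret cohn_elkies ?f ?g ?r
  proof
    show "?r > 0" using u0 by simp
    show "integrable lborel ?g" "integrable lborel ?f"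
      using integrable_gaussian_poly_cos[of \<alpha> _ "0::'a"] by simp_all
    show "?g \<xi> \<ge> 0" for \<xi> unfolding gaussian_poly_def by (intro mult_nonneg_nonneg nonneg) auto
    show "?f x = (LINT \<xi>|lborel. ?g \<xi> * cos (2 * pi * (x \<bullet> \<xi>)))" for x
      by (rule gaussian_poly_fourier[OF dim, symmetric])
    show "?f x \<le> 0" if "?r \<le> norm x" for x
    proof -
      have "u0 / pi \<le> (norm x)\<^sup>2" using that by (simp add: real_le_lsqrt real_sqrt_le_iff sqrt_le_D)
      then have "u0 \<le> pi * (x \<bullet> x)" by (simp add: power2_norm_eq_inner field_simps)
      then show ?thesis unfolding gaussian_poly_def using nonpos by (intro mult_nonpos_nonneg) auto
    qed
    show "0 < (LINT x|lborel. ?f x)" using p0 by (simp add: total)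
  qed
  have "?r / 2 = sqrt (u0 / (4 * pi))" by (simp add: real_sqrt_divide real_sqrt_mult)
  then have "(?r / 2) ^ DIM('a) = (u0 / (4 * pi)) ^ (\<alpha> + 1)"
    unfolding dim power_mult using u0 by simp
  moreover have "?f 0 / (LINT x|lborel. ?f x) = poly p 1 / coeff p 0"
    by (simp add: total gaussian_poly_zero)
  ultimately show ?thesis using packing_density_le[OF P] by simp
qed

section \<open>The lattice packings\<close>

text \<open>The cases of integral and half-odd coordinates are the parities of \<open>h\<close>.\<close>

lemma E8_lattice_iff:
  "v \<in> E8_lattice \<longleftrightarrow> (\<exists>h::int. \<forall>i. \<exists>k::int. v $ i = of_int k + of_int h / 2) \<and>
     (\<exists>m::int. even m \<and> (\<Sum>i\<in>UNIV. v $ i) = of_int m)"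
proof -
  have "(\<forall>i. v $ i \<in> \<int>) \<or> (\<forall>i. \<exists>k::int. odd k \<and> v $ i = of_int k / 2) \<longleftrightarrow>
      (\<exists>h::int. \<forall>i. \<exists>k::int. v $ i = of_int k + of_int h / 2)" (is "?L \<longleftrightarrow> ?R")
  proof
    assume ?L
    then show ?R
    proof
      assume "\<forall>i. v $ i \<in> \<int>"
      then show ?R by (intro exI[of _ 0]) (auto elim: Ints_cases)
    next
      assume odd: "\<forall>i. \<exists>k::int. odd k \<and> v $ i = of_int k / 2"
      have "\<exists>k::int. v $ i = of_int k + of_int 1 / 2" for i
      proof -
        obtain k :: int where "odd k" "v $ i = of_int k / 2" using odd by blast
        then obtain j where "k = 2 * j + 1" "v $ i = of_int k / 2" by (blast elim: oddE)
        then show ?thesis by (intro exI[of _ j]) (simp add: field_simps)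
      qed
      then show ?R by blast
    qed
  next
    assume ?R
    then obtain h :: int where h: "\<And>i. \<exists>k::int. v $ i = of_int k + of_int h / 2" by blast
    show ?L
    proof (cases "even h")
      case True
      then obtain j where "h = 2 * j" by (elim evenE)
      then have "v $ i \<in> \<int>" for i using h[of i] by auto
      then show ?L by blast
    next
      case False
      have "\<exists>k::int. odd k \<and> v $ i = of_int k / 2" for i
      proof -
        obtain k :: int where "v $ i = of_int k + of_int h / 2" using h by blast
        then show ?thesis using False by (intro exI[of _ "2 * k + h"]) (simp add: field_simps)
      qed
      then show ?L by blast
    qed
  qed
  then show ?thesis unfolding E8_lattice_def by blast
qed

lemma E8_lattice_diff:
  assumes "v \<in> E8_lattice" "w \<in> E8_lattice"
  shows "v - w \<in> E8_lattice"
proof -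
  obtain h h' m m' :: int
    where h: "\<And>i. \<exists>k::int. v $ i = of_int k + of_int h / 2" "\<And>i. \<exists>k::int. w $ i = of_int k + of_int h' / 2"
      and m: "even m" "(\<Sum>i\<in>UNIV. v $ i) = of_int m" "even m'" "(\<Sum>i\<in>UNIV. w $ i) = of_int m'"
    using assms unfolding E8_lattice_iff by blast
  have "\<exists>k::int. (v - w) $ i = of_int k + of_int (h - h') / 2" for i
  proof -
    obtain k k' :: int where "v $ i = of_int k + of_int h / 2" "w $ i = of_int k' + of_int h' / 2"
      using h by blast
    then show ?thesis by (intro exI[of _ "k - k'"]) (simp add: field_simps)
  qed
  moreover have "(\<Sum>i\<in>UNIV. (v - w) $ i) = of_int (m - m')" by (simp add: sum_subtractf m)
  moreover have "even (m - m')" using m by simp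
  ultimately show ?thesis unfolding E8_lattice_iff by blast
qed

text \<open>For integral vectors, \<open>v \<bullet> v\<close> has the parity of the sum of the coordinates; otherwise each of the eight
squares is at least \<open>1 / 4\<close>.\<close>

lemma E8_lattice_norm_ge:
  assumes v: "v \<in> E8_lattice" "v \<noteq> 0"
  shows "norm v \<ge> sqrt 2"
proof -
  have vv: "v \<bullet> v = (\<Sum>i\<in>UNIV. (v $ i)\<^sup>2)" by (simp add: inner_vec_def power2_eq_square)
  have pos: "v \<bullet> v > 0" using v(2) by simp
  have "v \<bullet> v \<ge> 2"
    using v(1) unfolding E8_lattice_def mem_Collect_eq
  proof (elim conjE disjE exE)
    fix m :: int assume int: "\<forall>i. v $ i \<in> \<int>" and m: "even m" "(\<Sum>i\<in>UNIV. v $ i) = of_int m"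
    have "\<forall>i. \<exists>k::int. v $ i = of_int k" using int by (auto elim: Ints_cases)
    then obtain k :: "8 \<Rightarrow> int" where k: "\<And>i. v $ i = of_int (k i)" by metis
    have "of_int (\<Sum>i\<in>UNIV. k i) = (of_int m :: real)" using m(2) by (simp add: k)
    then have "even (\<Sum>i\<in>UNIV. k i)" using m(1) by (simp only: of_int_eq_iff)
    moreover have "even ((\<Sum>i\<in>UNIV. (k i)\<^sup>2) - (\<Sum>i\<in>UNIV. k i))"
      unfolding sum_subtractf[symmetric] by (intro dvd_sum) (simp add: power2_eq_square)
    ultimately have ev: "even (\<Sum>i\<in>UNIV. (k i)\<^sup>2)" by simp
    have eq: "v \<bullet> v = of_int (\<Sum>i\<in>UNIV. (k i)\<^sup>2)" unfolding vv by (simp add: k)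
    with pos have "(\<Sum>i\<in>UNIV. (k i)\<^sup>2) > 0" by linarith
    with ev have "(\<Sum>i\<in>UNIV. (k i)\<^sup>2) \<ge> 2" by presburger
    then show ?thesis unfolding eq by linarith
  next
    assume half: "\<forall>i. \<exists>k::int. odd k \<and> v $ i = of_int k / 2"
    have "(v $ i)\<^sup>2 \<ge> 1 / 4" for i
    proof -
      obtain k :: int where k: "odd k" "v $ i = of_int k / 2" using half by blast
      then have "1 \<le> \<bar>k\<bar>" by presburger
      then have "1 \<le> k\<^sup>2" using abs_le_square_iff[of 1 k] by simp
      then have "1 \<le> (of_int k :: real)\<^sup>2" by (metis of_int_1 of_int_le_iff of_int_power)
      then show ?thesis by (simp add: k power_divide)
    qed
    then have "(\<Sum>i\<in>(UNIV::8 set). 1 / 4) \<le> v \<bullet> v" unfolding vv by (intro sum_mono) simp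
    then show ?thesis by simp
  qed
  then show ?thesis by (simp add: norm_eq_sqrt_inner)
qed

lemma E8_lattice_countable: "countable E8_lattice"
proof -
  have "E8_lattice \<subseteq> (\<lambda>k::8 \<Rightarrow> int. \<chi> i. of_int (k i) / 2) ` UNIV"
  proof
    fix v assume "v \<in> E8_lattice"
    then obtain h :: int where h: "\<And>i. \<exists>k::int. v $ i = of_int k + of_int h / 2"
      unfolding E8_lattice_iff by blast
    then obtain k :: "8 \<Rightarrow> int" where k: "\<And>i. v $ i = of_int (k i) + of_int h / 2" by metis
    show "v \<in> (\<lambda>k::8 \<Rightarrow> int. \<chi> i. of_int (k i) / 2) ` UNIV"
      by (rule image_eqI[of _ _ "\<lambda>i. 2 * k i + h"]) (simp_all add: vec_eq_iff k field_simps)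
  qed
  then show ?thesis by (rule countable_subset) simp
qed

text \<open>A closed fundamental box.  In \<open>E8_box_cover\<close>, the coordinate with side \<open>1 / 2\<close> decides between integral and
half-odd vectors, the sides of length 1 fix the coordinates in that class, and the last coordinate is
then only known modulo 2 by the parity of the sum.\<close>

definition E8_box :: "(real ^ 8) set" where
  "E8_box = cbox 0 (\<chi> i. if i = 0 then 1 / 2 else if i = 1 then 2 else 1)"

lemma E8_box_volume: "emeasure lborel E8_box = 1"
proof -
  let ?b = "\<chi> i. if i = 0 then 1 / 2 else if i = 1 then 2 else 1 :: real ^ 8"
  have ne: "cbox 0 ?b \<noteq> {}" by (simp add: interval_ne_empty_cart)
  have "(0::8) \<noteq> 1" by simp
  then have "(\<Prod>i\<in>UNIV. ?b $ i - (0 :: real ^ 8) $ i) = (\<Prod>i\<in>UNIV. (if i = (0::8) then 1 / 2 else 1) * (if i = 1 then 2 else 1))"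
    by (intro prod.cong) auto
  also have "\<dots> = 1" by (simp add: prod.distrib prod.delta)
  finally have "measure lborel E8_box = 1"
    unfolding E8_box_def using content_cbox_cart[OF ne] by simp
  then show ?thesis
    unfolding E8_box_def using emeasure_eq_ennreal_measure[of lborel "cbox 0 ?b"] emeasure_lborel_cbox_finite[of 0 ?b]
    by (simp add: less_top)
qed

lemma E8_box_cover: "\<exists>v\<in>E8_lattice. x - v \<in> E8_box"
proof -
  have ne: "(1::8) \<noteq> 0" by simp
  define k0 where "k0 = \<lfloor>2 * x $ 0\<rfloor>"
  define h :: int where "h = k0 mod 2"
  have h: "h = 0 \<or> h = 1" unfolding h_def by presburger
  define k where "k i = (if i = 0 then k0 div 2 else \<lfloor>x $ i - of_int h / 2\<rfloor>)" for i :: 8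
  let ?R = "UNIV - {1 :: 8}"
  define t where "t = of_int (\<Sum>i\<in>?R. k i) + 7 * (of_int h / 2 :: real)"
  define q where "q = \<lfloor>(x $ 1 + t) / 2\<rfloor>"
  define v :: "real ^ 8" where "v = (\<chi> i. if i = 1 then 2 * of_int q - t else of_int (k i) + of_int h / 2)"
  have card: "card ?R = 7" by simp
  have "(\<Sum>i\<in>UNIV. v $ i) = v $ 1 + (\<Sum>i\<in>?R. v $ i)" by (rule sum.remove) auto
  also have "(\<Sum>i\<in>?R. v $ i) = (\<Sum>i\<in>?R. of_int (k i) + of_int h / 2)"
    by (intro sum.cong) (auto simp: v_def)
  also have "\<dots> = t" unfolding t_def by (simp add: sum.distrib)
  finally have sum: "(\<Sum>i\<in>UNIV. v $ i) = of_int (2 * q)" by (simp add: v_def)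
  have "\<exists>j::int. v $ i = of_int j + of_int h / 2" for i
  proof (cases "i = 1")
    case True
    have "v $ 1 = of_int (2 * q - (\<Sum>i\<in>?R. k i) - 4 * h) + of_int h / 2"
      by (simp add: v_def t_def field_simps)
    then show ?thesis using True by blast
  qed (auto simp: v_def)
  then have "v \<in> E8_lattice" unfolding E8_lattice_iff using sum by (metis dvd_triv_left)
  moreover have "0 \<le> (x - v) $ i \<and> (x - v) $ i \<le> (if i = 0 then 1 / 2 else if i = 1 then 2 else 1)" for i
  proof -
    consider "i = 0" | "i = 1" | "i \<noteq> 0" "i \<noteq> 1" by blast
    then show ?thesis
    proof cases
      case 1
      have "k0 = 2 * (k0 div 2) + h" by (simp add: h_def)
      then have "(of_int k0 :: real) = 2 * of_int (k0 div 2) + of_int h" by (metis of_int_add of_int_mult of_int_numeral)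
      then have "v $ 0 = of_int k0 / 2" using ne by (simp add: v_def k_def field_simps)
      moreover have "of_int k0 \<le> 2 * x $ 0" "2 * x $ 0 < of_int k0 + 1" unfolding k0_def by linarith+
      ultimately show ?thesis using 1 by simp
    next
      case 2
      have "of_int q \<le> (x $ 1 + t) / 2" "(x $ 1 + t) / 2 < of_int q + 1" unfolding q_def by linarith+
      then show ?thesis using 2 ne by (simp add: v_def)
    next
      case 3
      have "of_int (k i) \<le> x $ i - of_int h / 2" "x $ i - of_int h / 2 < of_int (k i) + 1"
        using 3 by (simp_all add: k_def)
      then show ?thesis using 3 by (simp add: v_def)
    qed
  qed
  then have "x - v \<in> E8_box" unfolding E8_box_def by (simp add: mem_box_cart)
  ultimately show ?thesis by blast
qed

lemma E8_packing_density_ge: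
  "ennreal (unit_ball_vol 8 * (1 / 2) ^ 4) \<le> packing_density (lattice_packing E8_lattice)"
proof -
  have sep: "dist v w \<ge> sqrt 2" if "v \<in> E8_lattice" "w \<in> E8_lattice" "v \<noteq> w" for v w
    using E8_lattice_norm_ge[OF E8_lattice_diff[OF that(1,2)]] that(3) by (simp add: dist_norm)
  have "bounded E8_box" unfolding E8_box_def by (rule bounded_cbox)
  then obtain D where "\<forall>x\<in>E8_box. norm x \<le> D" unfolding bounded_iff by blast
  then have D: "E8_box \<subseteq> cball 0 D" by auto
  have "E8_lattice \<noteq> {} \<and> E8_lattice \<noteq> {0}"
  proof -
    have "(\<chi> i. 1) \<in> E8_lattice" unfolding E8_lattice_def by (auto intro!: exI[of _ 8])
    moreover have "(\<chi> i. 1) \<noteq> (0 :: real ^ 8)" by (simp add: vec_eq_iff)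
    ultimately show ?thesis by blast
  qed
  then have "min_length E8_lattice \<ge> sqrt 2" by (intro min_length_ge E8_lattice_norm_ge) auto
  then have "ennreal (unit_ball_vol DIM(real ^ 8) * (sqrt 2 / 2) ^ DIM(real ^ 8)) \<le> packing_density (lattice_packing E8_lattice)"
    using sep D by (intro lattice_packing_density_ge[where F = E8_box and D = D] E8_lattice_countable E8_box_cover)
       (auto simp: E8_box_volume, simp add: E8_box_def)
  moreover have "(sqrt 2 / 2) ^ 8 = (((sqrt 2 / 2)\<^sup>2) ^ 4 :: real)" by (simp flip: power_mult)
  then have "(sqrt 2 / 2) ^ 8 = ((1 / 2) ^ 4 :: real)" by (simp add: power_divide)
  ultimately show ?thesis by simp
qed

text \<open>A nonzero vector \<open>v\<close> of the lattice has \<open>v \<bullet> v\<close> even, positive and different from 2, hence at least 4.\<close>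

lemma Leech_packing_density_ge:
  fixes \<Lambda> :: "(real ^ 24) set"
  assumes "Leech_lattice \<Lambda>"
  shows "ennreal (unit_ball_vol 24) \<le> packing_density (lattice_packing \<Lambda>)"
proof -
  have eu: "is_lattice \<Lambda>" "covolume \<Lambda> = 1" and even: "\<And>v. v \<in> \<Lambda> \<Longrightarrow> \<exists>m::int. even m \<and> v \<bullet> v = of_int m"
    and short: "\<And>v. v \<in> \<Lambda> \<Longrightarrow> norm v \<noteq> sqrt 2"
    using assms unfolding Leech_lattice_def even_unimodular_def by auto
  obtain B where B: "lattice_basis \<Lambda> B" using eu(1) unfolding is_lattice_def by blast
  then have ind: "independent B" and span: "span B = UNIV"
    and L: "\<Lambda> = {v. \<exists>k::real^24 \<Rightarrow> int. v = (\<Sum>b\<in>B. of_int (k b) *\<^sub>R b)}"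
    unfolding lattice_basis_def by auto
  have fin: "finite B" using ind by (rule independent_imp_finite)
  let ?F = "fundamental_parallelepiped B"
  have norm_ge: "norm v \<ge> 2" if v: "v \<in> \<Lambda>" "v \<noteq> 0" for v
  proof -
    obtain m :: int where m: "even m" "v \<bullet> v = of_int m" using even[OF v(1)] by blast
    have "v \<bullet> v > 0" using v(2) by simp
    then have "m > 0" using m(2) by simp
    moreover have "m \<noteq> 2" using short[OF v(1)] m(2) by (auto simp: norm_eq_sqrt_inner)
    ultimately have "m \<ge> 4" using m(1) by presburger
    then have "v \<bullet> v \<ge> 2\<^sup>2" using m(2) by simp
    then show ?thesis unfolding norm_eq_sqrt_inner by (rule real_le_rsqrt)
  qed
  have diff: "v - w \<in> \<Lambda>" if vw: "v \<in> \<Lambda>" "w \<in> \<Lambda>" for v w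
  proof -
    obtain k l :: "real^24 \<Rightarrow> int" where "v = (\<Sum>b\<in>B. of_int (k b) *\<^sub>R b)" "w = (\<Sum>b\<in>B. of_int (l b) *\<^sub>R b)"
      using vw unfolding L by blast
    then have "v - w = (\<Sum>b\<in>B. of_int (k b - l b) *\<^sub>R b)"
      by (simp add: sum_subtractf scaleR_diff_left)
    then show ?thesis unfolding L mem_Collect_eq by (rule exI[of _ "\<lambda>b. k b - l b"])
  qed
  have "?F \<subseteq> cball 0 (\<Sum>b\<in>B. norm b)"
  proof
    fix x assume "x \<in> ?F"
    then obtain t :: "real^24 \<Rightarrow> real" where t: "\<forall>b\<in>B. 0 \<le> t b \<and> t b < 1" "x = (\<Sum>b\<in>B. t b *\<^sub>R b)"
      unfolding fundamental_parallelepiped_def by blast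
    have "norm x \<le> (\<Sum>b\<in>B. norm b)"
      unfolding t(2) using t(1) by (intro sum_norm_le) (auto intro!: mult_left_le_one_le)
    then show "x \<in> cball 0 (\<Sum>b\<in>B. norm b)" by simp
  qed
  moreover have "emeasure lborel ?F = 1"
  proof -
    have "measure lborel ?F = 1" using covolume_eq[OF B] eu(2) by simp
    moreover from this have "emeasure lborel ?F \<noteq> \<infinity>" by (auto simp: measure_def)
    ultimately show ?thesis using emeasure_eq_ennreal_measure[of lborel ?F] by simp
  qed
  moreover have "min_length \<Lambda> \<ge> 2"
  proof (rule min_length_ge[OF _ norm_ge])
    have "B \<noteq> {}" using span by (metis UNIV_I one_neq_zero singletonD span_empty zero_neq_one vec_eq_iff vec_component)
    then obtain b where b: "b \<in> B" by blast
    have "b = (\<Sum>c\<in>B. of_int (if c = b then 1 else 0) *\<^sub>R c)"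
      using fin b by (simp add: if_distrib[of of_int] if_distrib[of "\<lambda>x. x *\<^sub>R _"] sum.delta cong: if_cong)
    then have "b \<in> \<Lambda>" unfolding L mem_Collect_eq by (rule exI[of _ "\<lambda>c. if c = b then 1 else 0"])
    moreover have "b \<noteq> 0" using ind b dependent_zero by blast
    ultimately show "\<Lambda> - {0} \<noteq> {}" by blast
  qed
  moreover have "dist v w \<ge> 2" if "v \<in> \<Lambda>" "w \<in> \<Lambda>" "v \<noteq> w" for v w
    using norm_ge[OF diff[OF that(1,2)]] that(3) by (simp add: dist_norm)
  ultimately have "ennreal (unit_ball_vol DIM(real ^ 24) * 1 ^ DIM(real ^ 24)) \<le> packing_density (lattice_packing \<Lambda>)"
    using fundamental_parallelepiped_domain[OF B] fundamental_parallelepiped_borel[OF ind span] lattice_countable[OF B]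
    by (intro lattice_packing_density_ge[where F = ?F and D = "\<Sum>b\<in>B. norm b"]) (auto, blast)
  then show ?thesis by simp
qed

section \<open>Certificates for the signs of polynomials\<close>

text \<open>Polynomials are represented by the lists of their coefficients, constant term first, and evaluated by
Horner's rule.  All functions on lists are executable by rewriting.\<close>

primrec horner :: "int list \<Rightarrow> real \<Rightarrow> real" where
  "horner [] x = 0"
| "horner (a # l) x = of_int a + x * horner l x"

fun add_coeffs :: "int list \<Rightarrow> int list \<Rightarrow> int list" where
  "add_coeffs [] m = m"
| "add_coeffs l [] = l"
| "add_coeffs (a # l) (b # m) = (a + b) # add_coeffs l m"

lemma horner_add_coeffs: "horner (add_coeffs l m) x = horner l x + horner m x"
  by (induction l m rule: add_coeffs.induct) (auto simp: algebra_simps)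

lemma horner_scale: "horner (map ((*) c) l) x = of_int c * horner l x"
  by (induction l) (auto simp: algebra_simps)

definition mult_linear :: "int \<Rightarrow> int \<Rightarrow> int list \<Rightarrow> int list" where
  "mult_linear c d l = add_coeffs (map ((*) c) l) (0 # map ((*) d) l)"

lemma horner_mult_linear: "horner (mult_linear c d l) x = (of_int c + of_int d * x) * horner l x"
  by (simp add: mult_linear_def horner_add_coeffs horner_scale algebra_simps)

primrec compose_linear :: "int \<Rightarrow> int \<Rightarrow> int list \<Rightarrow> int list" where
  "compose_linear c d [] = []"
| "compose_linear c d (a # l) = add_coeffs [a] (mult_linear c d (compose_linear c d l))"

lemma horner_compose_linear: "horner (compose_linear c d l) x = horner l (of_int c + of_int d * x)"
  by (induction l) (auto simp: horner_add_coeffs horner_mult_linear)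

fun coeffs_le :: "int list \<Rightarrow> int list \<Rightarrow> bool" where
  "coeffs_le [] [] \<longleftrightarrow> True"
| "coeffs_le [] (b # m) \<longleftrightarrow> 0 \<le> b \<and> coeffs_le [] m"
| "coeffs_le (a # l) [] \<longleftrightarrow> a \<le> 0 \<and> coeffs_le l []"
| "coeffs_le (a # l) (b # m) \<longleftrightarrow> a \<le> b \<and> coeffs_le l m"

lemma coeffs_le_horner: "coeffs_le l m \<Longrightarrow> x \<ge> 0 \<Longrightarrow> horner l x \<le> horner m x"
  by (induction l m rule: coeffs_le.induct)
     (auto intro!: add_mono mult_left_mono add_nonneg_nonneg mult_nonneg_nonneg add_nonpos_nonpos mult_nonneg_nonpos)

text \<open>A proof that a polynomial \<open>p\<close> is nonnegative on the half line.  A positive multiple of \<open>p\<close> dominates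
coefficientwise the product of \<open>quotient\<close> with the squares of the factors \<open>root_denom * x - m\<close>, where \<open>m\<close>
runs over \<open>double_roots\<close>.  The quotient is nonnegative because it dominates the square of
\<open>x - residual_root\<close> times \<open>residual_quotient\<close>, whose coefficients are nonnegative.  The last step accounts
for complex roots with positive real part, which can make a few coefficients of the quotient negative;
if all of them are nonnegative, \<open>residual_quotient\<close> is empty.\<close>

record certificate =
  multiplier :: int
  root_denom :: int
  double_roots :: "int list"
  quotient :: "int list"
  residual_root :: int
  residual_quotient :: "int list"

definition mult_square :: "int \<Rightarrow> int \<Rightarrow> int list \<Rightarrow> int list" where
  "mult_square c d l = mult_linear (- c) d (mult_linear (- c) d l)"

lemma horner_mult_square: "horner (mult_square c d l) x = (of_int d * x - of_int c)\<^sup>2 * horner l x"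
  by (simp add: mult_square_def horner_mult_linear power2_eq_square algebra_simps)

definition valid_certificate :: "certificate \<Rightarrow> int list \<Rightarrow> bool" where
  "valid_certificate c p \<longleftrightarrow>
     0 < multiplier c \<and>
     coeffs_le (fold (\<lambda>m. mult_square m (root_denom c)) (double_roots c) (quotient c)) (map ((*) (multiplier c)) p) \<and>
     coeffs_le (mult_square (residual_root c) 1 (residual_quotient c)) (quotient c) \<and>
     coeffs_le [] (residual_quotient c)"

lemma valid_certificate_nonneg:
  assumes "valid_certificate c p" and x: "x \<ge> 0"
  shows "horner p x \<ge> 0"
proof -
  have K: "horner (residual_quotient c) x \<ge> 0"
    using assms coeffs_le_horner[of "[]" "residual_quotient c" x] by (auto simp: valid_certificate_def)
  have "horner (mult_square (residual_root c) 1 (residual_quotient c)) x \<le> horner (quotient c) x"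
    using assms by (intro coeffs_le_horner) (auto simp: valid_certificate_def)
  with K have H: "horner (quotient c) x \<ge> 0"
    by (simp add: horner_mult_square) (meson mult_nonneg_nonneg order_trans zero_le_power2)
  have A: "horner (fold (\<lambda>m. mult_square m d) ms l) x \<ge> 0" if "horner l x \<ge> 0" for d ms l
    using that by (induction ms arbitrary: l) (auto simp: horner_mult_square)
  have "0 \<le> horner (fold (\<lambda>m. mult_square m (root_denom c)) (double_roots c) (quotient c)) x"
    by (rule A[OF H])
  also have "\<dots> \<le> horner (map ((*) (multiplier c)) p) x"
    using assms by (intro coeffs_le_horner) (auto simp: valid_certificate_def)
  finally have "0 \<le> of_int (multiplier c) * horner p x" by (simp add: horner_scale)
  then show ?thesis using assms by (auto simp: valid_certificate_def zero_le_mult_iff)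
qed

text \<open>In the variable \<open>q * u\<close>, the result is a positive multiple of the polynomial with coefficients
\<open>a k / (m + k)!\<close> in \<open>u\<close>.  The second component is the factor by which the coefficient in front of the list
has to be multiplied.\<close>

fun clear_denoms :: "int \<Rightarrow> int \<Rightarrow> int list \<Rightarrow> int list \<times> int" where
  "clear_denoms m q [] = ([], 1)"
| "clear_denoms m q (a # l) = (let (r, f) = clear_denoms (m + 1) q l in (a * f # r, f * m * q))"

fun scale_powers :: "int \<Rightarrow> int \<Rightarrow> int list \<Rightarrow> int list" where
  "scale_powers h e [] = []"
| "scale_powers h e (a # l) = a * e # scale_powers h (e * h) l"

definition cleared :: "int \<Rightarrow> int \<Rightarrow> int list \<Rightarrow> int list" where
  "cleared m q l = fst (clear_denoms m q l)"

text \<open>The Borel transform, multiplied by \<open>fact m\<close>.\<close>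

primrec borel_horner :: "int \<Rightarrow> int list \<Rightarrow> real \<Rightarrow> real" where
  "borel_horner m [] u = 0"
| "borel_horner m (a # l) u = of_int a + u / (of_int m + 1) * borel_horner (m + 1) l u"

lemma poly_Poly_of_int: "poly (Poly (map of_int l)) x = horner l x"
  by (induction l) auto

lemma pcompose_Poly_of_int:
  "pcompose (Poly (map of_int l)) [:of_int c, of_int d:] = (Poly (map of_int (compose_linear c d l)) :: real poly)"
  by (rule poly_eq_poly_eq_iff[THEN iffD1], rule ext)
     (simp add: poly_pcompose poly_Poly_of_int horner_compose_linear mult.commute)

lemma borel_transform_pCons:
  "borel_transform \<alpha> (pCons a p) = pCons (a / fact \<alpha>) (borel_transform (Suc \<alpha>) p)"
  by (rule poly_eqI) (simp add: coeff_borel_transform coeff_pCons split: nat.split)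

lemma poly_borel_transform_Poly:
  "poly (borel_transform \<alpha> (Poly (map of_int l))) u = borel_horner (int \<alpha>) l u / fact \<alpha>"
proof (induction l arbitrary: \<alpha>)
  case Nil
  have "borel_transform \<alpha> 0 = 0" by (simp add: borel_transform_def)
  then show ?case by simp
next
  case (Cons a l)
  have "borel_horner (int (Suc \<alpha>)) l u = borel_horner (int \<alpha> + 1) l u" by (simp add: add.commute)
  moreover have "fact (Suc \<alpha>) = (real \<alpha> + 1) * fact \<alpha>" by (simp add: add.commute)
  ultimately show ?case
    by (simp add: borel_transform_pCons Cons.IH add_divide_distrib del: fact_Suc)
qed

lemma clear_denoms:
  assumes "m > 0" "q > 0"
  shows "snd (clear_denoms m q l) > 0"
    and "of_int (m * q) * horner (fst (clear_denoms m q l)) (of_int q * u) = of_int (snd (clear_denoms m q l)) * borel_horner m l u"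
  using assms
proof (induction m q l rule: clear_denoms.induct)
  case (2 m q a l)
  obtain r f where rf: "clear_denoms (m + 1) q l = (r, f)" by fastforce
  {
    case 1
    then show ?case using 2(1)[of] rf by simp
  next
    case 2
    have "of_int ((m + 1) * q) * horner r (of_int q * u) = of_int f * borel_horner (m + 1) l u"
      using "2.IH"(2) 2 rf by simp
    moreover have "real_of_int m + 1 > 0" using 2 by simp
    ultimately have "of_int q * horner r (of_int q * u) = of_int f * borel_horner (m + 1) l u / (of_int m + 1)"
      by (simp add: field_simps)
    then have "of_int q * u * horner r (of_int q * u) = of_int f * (u / (of_int m + 1) * borel_horner (m + 1) l u)"
      by (simp add: field_simps)
    then show ?case by (simp add: rf) (simp add: algebra_simps)
  }
qed auto

lemma nonneg_mult_pos_iff: "c > 0 \<Longrightarrow> 0 \<le> c * x \<longleftrightarrow> 0 \<le> x" for c x :: real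
  by (simp add: zero_le_mult_iff)

lemma cleared_nonneg_iff:
  assumes "m > 0" "q > 0"
  shows "horner (cleared m q l) (of_int q * u) \<ge> 0 \<longleftrightarrow> borel_horner m l u \<ge> 0"
proof -
  have "real_of_int (m * q) > 0" using assms by simp
  from nonneg_mult_pos_iff[OF this]
  have "0 \<le> horner (cleared m q l) (of_int q * u) \<longleftrightarrow> 0 \<le> of_int (m * q) * horner (cleared m q l) (of_int q * u)"
    by (rule sym)
  also have "\<dots> \<longleftrightarrow> 0 \<le> borel_horner m l u"
    unfolding cleared_def clear_denoms(2)[OF assms] using clear_denoms(1)[OF assms, of l]
    by (intro nonneg_mult_pos_iff) simp
  finally show ?thesis .
qed

lemma horner_uminus: "horner (map uminus l) x = - horner l x"
  by (induction l) auto

lemma horner_scale_powers: "horner (scale_powers h e l) x = of_int e * horner l (of_int h * x)"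
  by (induction l arbitrary: e) (simp_all add: algebra_simps)

lemma horner_append: "horner (l @ m) x = horner l x + x ^ length l * horner m x"
  by (induction l) (auto simp: algebra_simps)

text \<open>The statement is multiplied by \<open>x\<close> in order to avoid the exponent \<open>length l - 1\<close>.\<close>

lemma horner_rev:
  assumes "x \<noteq> 0"
  shows "x * horner (rev l) x = x ^ length l * horner l (1 / x)"
  using assms by (induction l) (auto simp: horner_append algebra_simps)

text \<open>The double roots lie beyond \<open>h\<close>, where the certificate applies to the polynomial in \<open>u - h\<close>.  On the
interval from 0 to \<open>h\<close> the substitution \<open>u = h / (1 + y)\<close> produces a polynomial in \<open>y\<close> with nonnegative
coefficients.\<close>

definition certifies_nonneg :: "int \<Rightarrow> int \<Rightarrow> certificate \<Rightarrow> int list \<Rightarrow> bool" where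
  "certifies_nonneg m h c l \<longleftrightarrow>
     valid_certificate c (compose_linear h 1 (cleared m 1 l)) \<and>
     coeffs_le [] (compose_linear 1 1 (rev (scale_powers h 1 (cleared m 1 l))))"

text \<open>The polynomial is shifted by \<open>u0 = n / q\<close>; in order to stay with integers, the variable is
\<open>q * u - n\<close>.\<close>

definition certifies_nonpos :: "int \<Rightarrow> int \<Rightarrow> int \<Rightarrow> certificate \<Rightarrow> int list \<Rightarrow> bool" where
  "certifies_nonpos m n q c l \<longleftrightarrow> valid_certificate c (map uminus (compose_linear n 1 (cleared m q l)))"

lemma certifies_nonneg_sound:
  assumes c: "certifies_nonneg m h c l" and m: "m > 0" and h: "h > 0" and u: "u > 0"
  shows "borel_horner m l u \<ge> 0"
proof (cases "u \<ge> of_int h")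
  case True
  have "0 \<le> horner (compose_linear h 1 (cleared m 1 l)) (u - of_int h)"
    using c True by (intro valid_certificate_nonneg) (auto simp: certifies_nonneg_def)
  then show ?thesis using cleared_nonneg_iff[of m 1 l u] m by (simp add: horner_compose_linear)
next
  case False
  let ?y = "of_int h / u" and ?l = "cleared m 1 l"
  have y: "?y > 1" using False u h by (simp add: field_simps)
  have "0 \<le> horner (compose_linear 1 1 (rev (scale_powers h 1 ?l))) (?y - 1)"
    using c y coeffs_le_horner[of "[]" _ "?y - 1"] by (auto simp: certifies_nonneg_def)
  then have "0 \<le> horner (rev (scale_powers h 1 ?l)) ?y" by (simp add: horner_compose_linear)
  then have "0 \<le> ?y * horner (rev (scale_powers h 1 ?l)) ?y" using y by (intro mult_nonneg_nonneg) auto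
  also have "\<dots> = ?y ^ length (scale_powers h 1 ?l) * horner ?l u"
    using y u h by (subst horner_rev) (auto simp: horner_scale_powers)
  finally have "0 \<le> horner ?l u" using y by (subst (asm) nonneg_mult_pos_iff) auto
  then show ?thesis using cleared_nonneg_iff[of m 1 l u] m by simp
qed

lemma certifies_nonpos_sound:
  assumes c: "certifies_nonpos m n q c l" and m: "m > 0" and q: "q > 0" and u: "u \<ge> of_int n / of_int q"
  shows "borel_horner m l u \<le> 0"
proof -
  have u': "of_int q * u - of_int n \<ge> 0" using u q by (simp add: field_simps)
  have "0 \<le> horner (map uminus (compose_linear n 1 (cleared m q l))) (of_int q * u - of_int n)"
    using c u' by (intro valid_certificate_nonneg) (auto simp: certifies_nonpos_def)
  then have *: "horner (cleared m q l) (of_int q * u) \<le> 0"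
    by (simp add: horner_uminus horner_compose_linear)
  have "of_int (m * q) * horner (cleared m q l) (of_int q * u) \<le> 0"
    using * m q by (intro mult_nonneg_nonpos) auto
  then show ?thesis
    unfolding cleared_def clear_denoms(2)[OF m q] using clear_denoms(1)[OF m q, of l]
    by (simp add: mult_le_0_iff)
qed

text \<open>The list \<open>l\<close> represents the Fourier transform \<open>g\<close>, and its image under \<open>X \<mapsto> 1 - X\<close> represents \<open>f\<close>.\<close>

theorem certified_packing_bound:
  assumes dim: "DIM('a::euclidean_space) = 2 * (\<alpha> + 1)" and \<alpha>: "\<alpha> > 0"
    and h: "h > 0" and n: "n > 0" and q: "q > 0"
    and l: "l = a # l'" "a > 0"
    and freq: "certifies_nonneg (int \<alpha>) h c l"
    and space: "certifies_nonpos (int \<alpha>) n q c' (compose_linear 1 (-1) l)"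
    and P: "sphere_packing (P :: 'a set set)"
  shows "packing_density P \<le> ennreal (horner l 1 / of_int a *
           (unit_ball_vol DIM('a) * (of_int n / of_int q / (4 * pi)) ^ (\<alpha> + 1)))"
proof -
  let ?p = "Poly (map of_int l) :: real poly"
  have p0: "coeff ?p 0 = of_int a" using l by simp
  have comp: "pcompose ?p [:1, -1:] = Poly (map of_int (compose_linear 1 (-1) l))"
    using pcompose_Poly_of_int[of l 1 "-1"] by simp
  have "packing_density P \<le> ennreal (poly ?p 1 / coeff ?p 0 * (unit_ball_vol DIM('a) * ((of_int n / of_int q) / (4 * pi)) ^ (\<alpha> + 1)))"
  proof (rule gaussian_cohn_elkies[OF dim _ _ _ _ P])
    show "0 \<le> poly (borel_transform \<alpha> ?p) u" if "u \<ge> 0" for u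
    proof (cases "u = 0")
      case True
      then show ?thesis using p0 l by (simp add: poly_0_coeff_0 coeff_borel_transform)
    next
      case False
      then show ?thesis
        using that certifies_nonneg_sound[OF freq _ h, of u] \<alpha> by (simp add: poly_borel_transform_Poly)
    qed
    show "poly (borel_transform \<alpha> (pcompose ?p [:1, -1:])) u \<le> 0" if "u \<ge> of_int n / of_int q" for u
      using certifies_nonpos_sound[OF space _ q that] \<alpha> unfolding comp poly_borel_transform_Poly
      by (simp add: divide_nonpos_pos)
  qed (use p0 l n q in auto)
  then show ?thesis unfolding p0 poly_Poly_of_int by simp
qed

section \<open>The test functions in dimensions 8 and 24\<close>

text \<open>The lists \<open>coeffs_8\<close> and \<open>coeffs_24\<close> describe \<open>g\<close> in the two dimensions.  They are rounded solutions of the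
linear program of minimizing \<open>f 0\<close> for given \<open>g 0\<close> among the polynomials of degree 49, with a small
margin in the sign conditions so that the conditions survive the rounding.  The first sign change
\<open>u0\<close> of \<open>f\<close> may be chosen freely near the value \<open>2 * pi\<close> (or \<open>4 * pi\<close>) that belongs to the
lattice itself, as it amounts to rescaling space; the values are \<open>61 / 10\<close> and 12.  If the
lattice is scaled so that its shortest vectors lie at the sign change, then the first double roots of \<open>f\<close> are
close to the lengths of its other vectors, and the first double roots of \<open>g\<close> to those of the vectors of the
dual lattice.  The quotient lists come from dividing the polynomials, reduced by the margin, by the
squared factors, and are scaled and rounded down.  In the case of \<open>f\<close> they contain one more factor for
the simple root at \<open>u0\<close>, which is why they begin with 0.\<close>

definition coeffs_8 :: "int list" where
  "coeffs_8 = [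
    60000000000000000000000000000000000000, 128739594789674390735709158307442010219,
    -98313178000357101399274220529060493278, -58846260119857756526284869021362351671,
    -205025272882671869929158286478786741521, 538417570102795261038395959055683297834,
    -1566360972288671733487876975513822556497, 9289158639685646171313560263179645503894,
    -61826608644548051717652338709251153514971, 429819867445999773429791197013743082243143,
    -2899319566973433625293309472308735402960441, 18417802927938347162100412581069955907754532,
    -109170695480652289174782792582427528500018907, 601676034551747529729847398148759188870651085,
    -3078551977318706112468185346813277692904187386,
    14611779717919312651260519948437962010992349742,
    -64297131359572761718720822892336873468520787241,
    262194971509309367792590573474321028055534987615,
    -990482762605202405319604561125104650850519002225,
    3465198459002532683619998431614177159003733824830,
    -11224094816572582475588945672091175618214759564439,
    33651502937765951385356743646415507227013104161744,
    -93361664466186984700788887160850761627079104935575,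
    239610528968974463687369761655166324601175135375183,
    -568653434991873591143064345246379574298893528556118,
    1247332805339488218664397995783996082177746239987554,
    -2527225562055693259868242727441836018580477220658506,
    4726078821120895249236510469228464384921379516306027,
    -8149749634598458389397864518283260377805919629080429,
    12944215808010831074738524730408943542145677600506458,
    -18910150679578518036693657683074406547428582976646291,
    25367915227450218853057691154570053409244865830268870,
    -31188473139132224408196542808936325512682656724617374,
    35060488786221354820421491715073330959293215246613782,
    -35939535871069222958125239973695219628722246747535883,
    33486048022726566992499124409756822115159351256744873,
    -28252000493697064449994679285539569910969219329273141,
    21487441167354491981153026595751315164271917883724659,
    -14654065525675849302622900330008026849587265131781427,
    8904238219992998385242842228579535131479124529341769,
    -4783436408416602887535339936846813147990934533724420,
    2250388573089019657680689401138662318105450742121218,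
    -916180229077776311807546193311158757751204908848332,
    317900134767391040820737493135501398276490653935776,
    -92139591956046753134954557243348976313872608732462,
    21698144716444131941380405489975261312741656234831,
    -3987459564769703525450130124210757303455467347523,
    536340553938528319243142985568677704349071361771,
    -46957202885988507881628478047955937693964671379, 2007885242668958280180434873892012725800449489]"

definition quotient_space_8 :: "int list" where
  "quotient_space_8 = [
    0, 2522398694299570589386827897107171454219866819344581571068021352512118881,
    296522267836488559415210042839124644307959461653915520795465790302114594,
    17274280655109739646938280043714914409907817507841365814507020344812085,
    663766789206153841254502418944511092142065716594186602207050143543284,
    18905118313464879631813406396576736390219057283273060044989294392447,
    425387709262763285884940097764314934962844320385297100492444438386,
    7872341220570016442934661023364070100367557647089311133956213861,
    123184453928995476602839481360106954515509714038296336009637564,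
    1663023362812264346016211194613676226576822730394195066817983,
    19668597329731704821476334976384164595826402978765474283808,
    206248226758137733401743048272731834887250626386130091215,
    1936373882513224831748940454080957338293276171266906409,
    16405985043702681008443152968200531560721102242131672,
    126068764504891282806793574803330386044920543793178,
    880903526194071703975761169593912397208151373525,
    5662899507525181761153565736979707924456808300, 34476180459826103610368494786558336719443643,
    193448376317282580657015825340386163367588, 839729038186276136405275805506618431588,
    3009408727274126503821176981364368882, 25707587843235097031759358371154650,
    170836797496689291569729857102852, -155402431009711544449207676539,
    -1911369796658488584382270840, 20078852426689582801804347]"

definition cert_space_8 :: certificate where
  "cert_space_8 = \<lparr>multiplier = 10 ^ 28, root_denom = 100,
    double_roots = [6100, 12200, 18301, 24406, 30523, 36710, 43029, 49821, 57066, 65894, 76351, 91343],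
    quotient = quotient_space_8, residual_root = 120, residual_quotient = (replicate 22 0 @ [2907554785747011288050772440, 20078852426689582801804347])\<rparr>"

definition quotient_freq_8 :: "int list" where
  "quotient_freq_8 = [
    76417103320273943962152745237671015166450882527182998,
    81147414452012408324354128716273595013947404402078551,
    42458514332107117168651532723568982483626765215788074,
    14620062370008558258802828591771839074022543038003645,
    3730686965594653638593338414390248261591386773996984,
    752881352202989388322102457290978117647436548697437,
    125192997066711986803658506259025401906423501456118,
    17643560540698402499941931147232453690688930948800,
    2150989282794069909871369959828523395091362743521,
    230388488842852303434345320255436995758145477933,
    21942466164500209653352216168718978957370919644,
    1876202874986787716470219114197701216110240447, 145166395291197928107096931710842961215356011,
    10230736863253161052399030198074070871210181, 659891893596043525229168697095901412854932,
    39033538849785873713968978479180873016572, 2126776958076899308475236849697339289742,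
    108902462865904769988565066197634735074, 5278590116101565614976099063990971188,
    217118073068606621829890715579972394, 6822382595866618043416550322786060,
    356463687148690582895659295762687, 24980869540470582008742632844227,
    126426365415843276488008488059, -28292472612829219151237781611, 2007885242668958280180434872]"

definition cert_freq_8 :: certificate where
  "cert_freq_8 = \<lparr>multiplier = 10 ^ 54, root_denom = 1000,
    double_roots = [472, 6944, 13416, 19888, 26365, 32856, 39423, 46138, 53395, 61200, 70868, 83036],
    quotient = quotient_freq_8, residual_root = 12, residual_quotient = (replicate 22 0 @ [19896773211225779573092655317, 2007885242668958280180434872])\<rparr>"

definition coeffs_24 :: "int list" where
  "coeffs_24 = [
    3991680000000000000000000000000000000, 28805874234428935842379639457226152059,
    19149162179079833228013961283423935913, 62312639440401385877101771156833308637,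
    -813461951996715615123180049788345828460, 8559373851672122496132612416831636551435,
    -108123487330416350186065472040087122219742, 1237395731347861120263355713830482050685901,
    -12623107634605758235795861761413322865262480, 114482384884459216921300355142830673081327336,
    -925800411860180178931863096418851065098901163, 6707969443326578351684035792812214070683725086,
    -43757780852611068544178823978285546301343547120,
    258122838476857006164268192372197753420413448266,
    -1382278704843637336045418813682149757965012377341,
    6742629147426948980166910833921786938969228547692,
    -30045914321759898572472539204006398675636520590119,
    122612082931137942415711303948649198012264287121556,
    -459168231086242266598631002982509088751255724366679,
    1580688333106160611671670703536814626041419409969211,
    -5009119326292454089445217605619921106111452627424213,
    14628264615782890513614136685708257345065496901406756,
    -39399929564394605356832145786065986743336025044507488,
    97928684617450967935567731320491575350810018909363231,
    -224681328356042925916969099140635269184009749244389735,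
    475871838592569940425674983580072782908237507063427334,
    -930241426235703895236973502852612936996707574628895220,
    1677617203921470863872471113615515528549005222141033501,
    -2789199793473262941976506802700346610398886430367222243,
    4271083393598452344412689556693002962152697157973491825,
    -6016265012236058802902831688283580467457349226682131708,
    7783443112712702316617181210554058786245881934102090465,
    -9231050281106732383890036366036137486937708008544926249,
    10013354952938540288776218198172030120650446772196315738,
    -9907982172019491111338608950321644708069340851198355041,
    8914154504886315751172687042156654501448725858586687137,
    -7264786723891195834916705867464458594162346020826001222,
    5339097601079498182445495161307731961209540687859026109,
    -3519643597274989585181615904192182591824887318244204467,
    2067934361771648542203498845381309137100166384065030856,
    -1074519659184428045174774756184633102122771347800440113,
    489095164950663458502660784773982369958475118756819002,
    -192706787988370698177532327812836748803293580284374239,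
    64728732148121057299756139216768976032634621381547964,
    -18165364264170260547181035301231979941297286731614590,
    4142895538832868090253167083676322552694602216327832,
    -737469802402721117246484079452121520023961923101080,
    96101247022268891961312742556509084142063763994477,
    -8152592881830857638330781310947459113829357251030,
    337826051417389049797435311654038881662048476520]"

definition quotient_space_24 :: "int list" where
  "quotient_space_24 = [
    0, 32333115002384844978739288612179188083733069141655,
    30218518586158574121386445977929968472559119584290,
    14028884750726792189622449687102398085184771443837,
    4309394865933703842379655500290166934668806043940,
    984496302137025063835214493359876698210245106387,
    178265469240642431762796604800912491402059692302,
    26627367199504969378170504746428834175896091213,
    3371691257855110937941596160775365060225608564, 369131169437026896886326062505417383793715563,
    35460147589373618055680034110073520381348300, 3023147424146934804436437211176260564011240,
    230774989512787975587642268865456566655994, 15883946457551512795466613307286165567728,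
    991182938912265422576970028876867648915, 56315187281566924445100600801121098152,
    2921930413302741563760419338032829756, 138621303072327982927794246020708756,
    6009223219645283221912480844927488, 237922540196504420859988924471513,
    8640887700084869785693178375480, 289620513943206383671470496054, 8780701414752983493435723471,
    220849558050324713083106950, 3876588116018837710988015, 33782605141738904979742]"

definition cert_space_24 :: certificate where
  "cert_space_24 = \<lparr>multiplier = 10 ^ 23, root_denom = 100,
    double_roots = [600, 1201, 1802, 2406, 3017, 3643, 4297, 4997, 5764, 6629, 7644, 8940],
    quotient = quotient_space_24, residual_root = 0, residual_quotient = []\<rparr>"

definition quotient_freq_24 :: "int list" where
  "quotient_freq_24 = [
    21263473326871076384286772916380675767847345427644461994,
    18598487736154796387396405501776619721926043742918593623,
    8063235782183807564685100820824823878640794289004721165,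
    2310519697109730981198386321093857783381056784122909113,
    492269133458819201175502331873066443141856158290908540,
    83163667095474016157292026246019323284231872339574595,
    11601179801892333110683484531519821306613805408854991,
    1373952585059779097577452184916476554905288679881761,
    140956982879039023134770464243099884882821754156732,
    12718488864875861340768728101013530684678630387159,
    1021224584326585516820581685233373422257525786474,
    73649689401058283088618246898821988270070120427,
    4806126319847823540719378307064460251081279616, 285462466844678250252944329420437103090702224,
    15503897585157289327807113052458847591515724, 772808797379938672695743532186923178166789,
    35468142346745150512482006293368240310119, 1502658121720579148007428669493894142070,
    58740975945589011346706837012345821642, 2105151485053529012567830589421755900,
    68784171372083878943518103192417986, 2088250018501372800799513685475906,
    61277026379922642096820502060854, 1660396328391603561192404761832,
    33501867759019488422761232262, 337826051417389049797435308]"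

definition cert_freq_24 :: certificate where
  "cert_freq_24 = \<lparr>multiplier = 10 ^ 27, root_denom = 100,
    double_roots = [116, 774, 1433, 2092, 2755, 3426, 4114, 4836, 5617, 6488, 7506, 8799],
    quotient = quotient_freq_24, residual_root = 0, residual_quotient = []\<rparr>"

lemma cert_freq_8: "certifies_nonneg 3 6 cert_freq_8 coeffs_8"
  by code_simp

lemma cert_space_8: "certifies_nonpos 3 61 10 cert_space_8 (compose_linear 1 (-1) coeffs_8)"
  by code_simp

lemma cert_freq_24: "certifies_nonneg 11 12 cert_freq_24 coeffs_24"
  by code_simp

lemma cert_space_24: "certifies_nonpos 11 12 1 cert_space_24 (compose_linear 1 (-1) coeffs_24)"
  by code_simp

section \<open>The density bounds\<close>

lemma packing_density_8_le:
  assumes "sphere_packing (P :: (real ^ 8) set set)"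
  shows "packing_density P \<le> ennreal 1.000001 * ennreal (unit_ball_vol 8 * (1 / 2) ^ 4)"
proof -
  let ?a = "hd coeffs_8"
  have l: "coeffs_8 = ?a # tl coeffs_8" "?a > 0" by (simp_all add: coeffs_8_def)
  have "packing_density P \<le> ennreal (horner coeffs_8 1 / of_int ?a * (unit_ball_vol 8 * (of_int 61 / of_int 10 / (4 * pi)) ^ 4))"
    using certified_packing_bound[where \<alpha> = 3 and h = 6 and n = 61 and q = 10 and P = P, OF _ _ _ _ _ l _ _ assms]
      cert_freq_8 cert_space_8 by simp
  also have "\<dots> \<le> ennreal (1.000001 * (unit_ball_vol 8 * (1 / 2) ^ 4))"
  proof (rule ennreal_leI)
    have pi: "3.141592653588 \<le> pi" by (rule pi_approx)
    \<comment> \<open>After \<open>pi\<close> has been replaced by a lower bound, the claim compares rational numbers.\<close>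
    have "(of_int 61 / of_int 10 / (4 * pi)) ^ 4 \<le> (6.1 / (4 * 3.141592653588)) ^ 4"
      using pi by (intro power_mono divide_left_mono frac_le) auto
    then have "horner coeffs_8 1 / of_int ?a * (of_int 61 / of_int 10 / (4 * pi)) ^ 4
       \<le> horner coeffs_8 1 / of_int ?a * (6.1 / (4 * 3.141592653588)) ^ 4"
      by (rule mult_left_mono) (simp add: coeffs_8_def)
    also have "\<dots> \<le> 1.000001 * (1 / 2) ^ 4"
      by (simp add: coeffs_8_def power_divide)
    finally have "horner coeffs_8 1 / of_int ?a * (of_int 61 / of_int 10 / (4 * pi)) ^ 4 * unit_ball_vol 8
       \<le> 1.000001 * (1 / 2) ^ 4 * unit_ball_vol 8"
      by (rule mult_right_mono) (simp add: less_imp_le)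
    then show "horner coeffs_8 1 / of_int ?a * (unit_ball_vol 8 * (of_int 61 / of_int 10 / (4 * pi)) ^ 4)
       \<le> 1.000001 * (unit_ball_vol 8 * (1 / 2) ^ 4)" by (simp only: mult_ac)
  qed
  also have "\<dots> = ennreal 1.000001 * ennreal (unit_ball_vol 8 * (1 / 2) ^ 4)"
    by (rule ennreal_mult) simp_all
  finally show ?thesis .
qed

lemma packing_density_24_le:
  assumes "sphere_packing (P :: (real ^ 24) set set)"
  shows "packing_density P \<le> ennreal 1.0007071 * ennreal (unit_ball_vol 24)"
proof -
  let ?a = "hd coeffs_24"
  have l: "coeffs_24 = ?a # tl coeffs_24" "?a > 0" by (simp_all add: coeffs_24_def)
  have "packing_density P \<le> ennreal (horner coeffs_24 1 / of_int ?a * (unit_ball_vol 24 * (of_int 12 / of_int 1 / (4 * pi)) ^ 12))"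
    using certified_packing_bound[where \<alpha> = 11 and h = 12 and n = 12 and q = 1 and P = P, OF _ _ _ _ _ l _ _ assms]
      cert_freq_24 cert_space_24 by simp
  also have "\<dots> \<le> ennreal (1.0007071 * unit_ball_vol 24)"
  proof (rule ennreal_leI)
    have pi: "3.141592653588 \<le> pi" by (rule pi_approx)
    have "(of_int 12 / of_int 1 / (4 * pi)) ^ 12 \<le> (12 / (4 * 3.141592653588)) ^ 12"
      using pi by (intro power_mono divide_left_mono frac_le) auto
    then have "horner coeffs_24 1 / of_int ?a * (of_int 12 / of_int 1 / (4 * pi)) ^ 12
       \<le> horner coeffs_24 1 / of_int ?a * (12 / (4 * 3.141592653588)) ^ 12"
      by (rule mult_left_mono) (simp add: coeffs_24_def)
    also have "\<dots> \<le> 1.0007071"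
      by (simp add: coeffs_24_def power_divide)
    finally have "horner coeffs_24 1 / of_int ?a * (of_int 12 / of_int 1 / (4 * pi)) ^ 12 * unit_ball_vol 24
       \<le> 1.0007071 * unit_ball_vol 24"
      by (rule mult_right_mono) (simp add: less_imp_le)
    then show "horner coeffs_24 1 / of_int ?a * (unit_ball_vol 24 * (of_int 12 / of_int 1 / (4 * pi)) ^ 12)
       \<le> 1.0007071 * unit_ball_vol 24" by (simp only: mult_ac)
  qed
  also have "\<dots> = ennreal 1.0007071 * ennreal (unit_ball_vol 24)"
    by (rule ennreal_mult) simp_all
  finally show ?thesis .
qed

theorem mainTheorem3:
  "(\<forall>P :: (real ^ 8) set set. sphere_packing P \<longrightarrow>
      packing_density P \<le> ennreal 1.000001 * packing_density (lattice_packing E8_lattice)) \<and>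
   (\<forall>(\<Lambda> :: (real ^ 24) set) (P :: (real ^ 24) set set). Leech_lattice \<Lambda> \<longrightarrow> sphere_packing P \<longrightarrow>
      packing_density P \<le> ennreal 1.0007071 * packing_density (lattice_packing \<Lambda>))"
proof (intro conjI allI impI)
  fix P :: "(real ^ 8) set set" assume "sphere_packing P"
  from packing_density_8_le[OF this] E8_packing_density_ge
  show "packing_density P \<le> ennreal 1.000001 * packing_density (lattice_packing E8_lattice)"
    by (meson mult_left_mono order_trans zero_le)
next
  fix \<Lambda> :: "(real ^ 24) set" and P :: "(real ^ 24) set set"
  assume "Leech_lattice \<Lambda>" "sphere_packing P"
  from packing_density_24_le[OF this(2)] Leech_packing_density_ge[OF this(1)]
  show "packing_density P \<le> ennreal 1.0007071 * packing_density (lattice_packing \<Lambda>)"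
    by (meson mult_left_mono order_trans zero_le)
qed

end
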